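(* Let $\mathscr L$ be a sequence of (linearly dependent, equiangular) lines having normalized signature matrix $\mathcal S$. Then $\mathscr L$ forms DRACKN lines if and only if (a) every off-diagonal entry of $\mathcal S$ is an $r$th root of unity for some minimal $r>0$, and (b) there exist $\theta$ and $\tau$ such that for every $k\in\{1,\dots,r-1\}$, $\mathcal S^{\circ k}$ has spectrum $\{\theta,\tau\}$.
   Context: A signature matrix is a self-adjoint complex matrix with zero diagonal and unit-modulus off-diagonal entries. Unit vectors $\{\varphi_i\}_{i\in[n]}$ have signature matrix $\mathcal S$ if their Gram matrix $(\langle\varphi_j,\varphi_i\rangle)_{ij}$ equals $I+\mu\mathcal S$ with $\mu>0$; lines through the origin having such unit-norm representatives are equiangular. A sequence of $n$ lines is linearly dependent if its span has dimension less than $n$. The signature matrix of the lines is normalized when the unit-norm representatives are chosen so that $\mathcal S_{1i}=\mathcal S_{i1}=1$ for all $i\ne1$. The Hadamard power is defined by $(\mathcal S^{\circ k})_{ij}=(\mathcal S_{ij})^k$. The spectrum is the set of eigenvalues. A roux for a finite abelian group $\Gamma$ (identified with its image in the group ring $\mathbb{C}[\Gamma]$) is a matrix $B\in\mathbb{C}[\Gamma]^{n\times n}$ such that (R1) $B_{ii}=0$ for every $i$; (R2) $B_{ij}\in\Gamma$ for $i\ne j$; (R3) $B_{ji}=(B_{ij})^{-1}$ for $i\ne j$; (R4) $\{gI\}_{g\in\Gamma}$ and $\{gB\}_{g\in\Gamma}$ span an algebra. For a character $\alpha\in\hat\Gamma$, $\hat\alpha(B)$ (evaluating $B$ at $\alpha$)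 applies the linear extension of $\alpha$ to each entry of $B$. $\lceil B\rfloor$ applies the Cayley representation of $\Gamma$, extended linearly, to each entry of $B$ (for $x\in\Gamma$, the $(g,h)$ entry of the image is $1$ if $xh=g$ and $0$ otherwise). The roux graph of $B$ is the graph on $[n]\times\Gamma$ with adjacency matrix $\lceil B\rfloor$; its fibres are the sets $\{i\}\times\Gamma$. Graphs are simple. A graph is distance-regular if for every ordered pair $(u,v)$ of vertices the number of vertices simultaneously at distance $i$ from $u$ and distance $j$ from $v$ is determined by $i$, $j$ and the distance between $u$ and $v$. A cover of the complete graph is a graph with a partition of its vertices into independent sets (fibres) such that the union of any two distinct fibres induces a perfect matching. A DRACKN (distance-regular antipodal cover of the complete graph) is a connected, distance-regular cover of the complete graph in which two distinct vertices are at distance equal to the diameter if and only if they lie in the same fibre. Writing the adjacency matrix $A$ of a cover with fibres of size $s$ in $s\times s$ blocks $A_{ij}$, normalize it to $DAD^{-1}$ with $D$ block diagonal with first block the identity and $j$th block $A_{1j}$ ($j>1$); let $\Pi\le S_s$ be generated by the permutations represented by the off-diagonal blocks of the normalized matrix. The cover is regular if $\Pi$ acts regularly on $[s]$ and abelian if $\Pi$ is abelian. DRACKN lines: a sequence of linearly dependent lines for which there exist unit-norm representatives whose signature matrix is $\hat\alpha(B)$ for some character $\alpha\in\hat\Gamma$ and some roux $B$ for a finite abelian group $\Gamma$ whose roux graph is a regular abelian DRACKN.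
   Formalization: The formal theorem assumes n > 2: for n = 2 dependent lines are one line taken twice, (a) and (b) hold with r = 1, yet no DRACKN has exactly two fibres. The finite abelian group Γ is taken with natural numbers as elements, which loses nothing up to isomorphism. *)

theory Defs
  imports
    "HOL-Library.Extended_Nat"
    "HOL-Library.Disjoint_Sets"
    "HOL-Algebra.Generated_Groups"
    "HOL-Algebra.Sym_Groups"
    "Jordan_Normal_Form.Matrix"
    "Jordan_Normal_Form.VS_Connect"
    "Jordan_Normal_Form.Schur_Decomposition"
    "Jordan_Normal_Form.Spectral_Radius"
    "Graph_Theory.Pair_Digraph"
    "Graph_Theory.Digraph_Component"
begin

text \<open>Indices run over \<open>{0..<n}\<close>, as usual for the matrix library; index \<open>0\<close> plays the role
  of the first index in every normalization.\<close>


section \<open>Equiangular lines and signature matrices\<close>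

definition line_through :: "complex vec \<Rightarrow> complex vec set" where
  "line_through v = range (\<lambda>c. c \<cdot>\<^sub>v v)"

definition is_line :: "nat \<Rightarrow> complex vec set \<Rightarrow> bool" where
  "is_line d l \<longleftrightarrow> (\<exists>v \<in> carrier_vec d. v \<noteq> 0\<^sub>v d \<and> l = line_through v)"

definition linearly_dependent_lines :: "nat \<Rightarrow> nat \<Rightarrow> (nat \<Rightarrow> complex vec set) \<Rightarrow> bool" where
  "linearly_dependent_lines d n L \<longleftrightarrow>
     vectorspace.dim class_ring
       ((module_vec TYPE(complex) d)
          \<lparr>carrier := LinearCombinations.module.span class_ring (module_vec TYPE(complex) d)
                        (\<Union>i<n. L i)\<rparr>) < n"

definition signature_matrix :: "nat \<Rightarrow> complex mat \<Rightarrow> bool" where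
  "signature_matrix n S \<longleftrightarrow> S \<in> carrier_mat n n \<and> mat_adjoint S = S \<and>
     (\<forall>i<n. S $$ (i, i) = 0) \<and>
     (\<forall>i<n. \<forall>j<n. i \<noteq> j \<longrightarrow> cmod (S $$ (i, j)) = 1)"

text \<open>The library's \<open>v \<bullet>c w\<close> is linear in \<open>v\<close> and conjugate-linear in \<open>w\<close>.\<close>

definition gram_matrix :: "nat \<Rightarrow> (nat \<Rightarrow> complex vec) \<Rightarrow> complex mat" where
  "gram_matrix n \<phi> = mat n n (\<lambda>(i, j). \<phi> j \<bullet>c \<phi> i)"

definition vectors_have_signature_matrix ::
    "nat \<Rightarrow> (nat \<Rightarrow> complex vec) \<Rightarrow> complex mat \<Rightarrow> bool" where
  "vectors_have_signature_matrix n \<phi> S \<longleftrightarrow> signature_matrix n S \<and>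
     (\<exists>\<mu>::real. \<mu> > 0 \<and> gram_matrix n \<phi> = 1\<^sub>m n + complex_of_real \<mu> \<cdot>\<^sub>m S)"

definition unit_norm_representatives ::
    "nat \<Rightarrow> nat \<Rightarrow> (nat \<Rightarrow> complex vec set) \<Rightarrow> (nat \<Rightarrow> complex vec) \<Rightarrow> bool" where
  "unit_norm_representatives d n L \<phi> \<longleftrightarrow>
     (\<forall>i<n. \<phi> i \<in> carrier_vec d \<and> \<phi> i \<bullet>c \<phi> i = 1 \<and> L i = line_through (\<phi> i))"

definition lines_have_signature_matrix ::
    "nat \<Rightarrow> nat \<Rightarrow> (nat \<Rightarrow> complex vec set) \<Rightarrow> complex mat \<Rightarrow> bool" where
  "lines_have_signature_matrix d n L S \<longleftrightarrow>
     (\<exists>\<phi>. unit_norm_representatives d n L \<phi> \<and> vectors_have_signature_matrix n \<phi> S)"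

definition equiangular_lines :: "nat \<Rightarrow> nat \<Rightarrow> (nat \<Rightarrow> complex vec set) \<Rightarrow> bool" where
  "equiangular_lines d n L \<longleftrightarrow> (\<exists>S. lines_have_signature_matrix d n L S)"

definition normalized_signature_matrix ::
    "nat \<Rightarrow> nat \<Rightarrow> (nat \<Rightarrow> complex vec set) \<Rightarrow> complex mat \<Rightarrow> bool" where
  "normalized_signature_matrix d n L S \<longleftrightarrow> lines_have_signature_matrix d n L S \<and>
     (\<forall>i<n. i \<noteq> 0 \<longrightarrow> S $$ (0, i) = 1 \<and> S $$ (i, 0) = 1)"

definition hadamard_power :: "complex mat \<Rightarrow> nat \<Rightarrow> complex mat" where
  "hadamard_power S k = map_mat (\<lambda>z. z ^ k) S"


section \<open>Roux\<close>

text \<open>An element of the group ring \<open>\<complex>[\<Gamma>]\<close> of a finite group is its coefficient function, which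
  vanishes off the carrier; \<open>gr_of\<close> identifies the group with its image.\<close>

definition gr_carrier :: "('g, 'm) monoid_scheme \<Rightarrow> ('g \<Rightarrow> complex) set" where
  "gr_carrier \<Gamma> = {f. \<forall>x. x \<notin> carrier \<Gamma> \<longrightarrow> f x = 0}"

definition gr_of :: "'g \<Rightarrow> ('g \<Rightarrow> complex)" where
  "gr_of g = (\<lambda>x. if x = g then 1 else 0)"

definition gr_mult ::
    "('g, 'm) monoid_scheme \<Rightarrow> ('g \<Rightarrow> complex) \<Rightarrow> ('g \<Rightarrow> complex) \<Rightarrow> ('g \<Rightarrow> complex)" where
  "gr_mult \<Gamma> f h = (\<lambda>x. if x \<in> carrier \<Gamma>
     then \<Sum>y \<in> carrier \<Gamma>. f y * h (inv\<^bsub>\<Gamma>\<^esub> y \<otimes>\<^bsub>\<Gamma>\<^esub> x) else 0)"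

text \<open>The matrix operations of the library need type classes on the entries, so the ones over
  \<open>\<complex>[\<Gamma>]\<close> are spelled out.\<close>

definition gr_one_mat :: "('g, 'm) monoid_scheme \<Rightarrow> nat \<Rightarrow> ('g \<Rightarrow> complex) mat" where
  "gr_one_mat \<Gamma> n = mat n n (\<lambda>(i, j). if i = j then gr_of \<one>\<^bsub>\<Gamma>\<^esub> else (\<lambda>_. 0))"

definition gr_mat_mult ::
    "('g, 'm) monoid_scheme \<Rightarrow> ('g \<Rightarrow> complex) mat \<Rightarrow> ('g \<Rightarrow> complex) mat \<Rightarrow> ('g \<Rightarrow> complex) mat" where
  "gr_mat_mult \<Gamma> X Y = mat (dim_row X) (dim_col Y)
     (\<lambda>(i, j). \<lambda>x. \<Sum>k < dim_col X. gr_mult \<Gamma> (X $$ (i, k)) (Y $$ (k, j)) x)"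

definition gr_translate ::
    "('g, 'm) monoid_scheme \<Rightarrow> 'g \<Rightarrow> ('g \<Rightarrow> complex) mat \<Rightarrow> ('g \<Rightarrow> complex) mat" where
  "gr_translate \<Gamma> g X = map_mat (gr_mult \<Gamma> (gr_of g)) X"

definition gr_span :: "nat \<Rightarrow> ('g \<Rightarrow> complex) mat set \<Rightarrow> ('g \<Rightarrow> complex) mat set" where
  "gr_span n \<A> = {mat n n (\<lambda>(i, j). \<lambda>x. \<Sum>M\<in>F. c M * (M $$ (i, j)) x) | F c.
     finite F \<and> F \<subseteq> \<A>}"

definition roux :: "('g, 'm) monoid_scheme \<Rightarrow> nat \<Rightarrow> ('g \<Rightarrow> complex) mat \<Rightarrow> bool" where
  "roux \<Gamma> n B \<longleftrightarrow>
     comm_group \<Gamma> \<and> finite (carrier \<Gamma>) \<and>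
     B \<in> carrier_mat n n \<and> (\<forall>i<n. \<forall>j<n. B $$ (i, j) \<in> gr_carrier \<Gamma>) \<and>
     (\<forall>i<n. B $$ (i, i) = (\<lambda>_. 0)) \<and>
     (\<forall>i<n. \<forall>j<n. i \<noteq> j \<longrightarrow> B $$ (i, j) \<in> gr_of ` carrier \<Gamma>) \<and>
     (\<forall>i<n. \<forall>j<n. i \<noteq> j \<longrightarrow>
        (\<forall>g \<in> carrier \<Gamma>. B $$ (i, j) = gr_of g \<longrightarrow> B $$ (j, i) = gr_of (inv\<^bsub>\<Gamma>\<^esub> g))) \<and>
     (let W = gr_span n ((\<lambda>g. gr_translate \<Gamma> g (gr_one_mat \<Gamma> n)) ` carrier \<Gamma> \<union>
                         (\<lambda>g. gr_translate \<Gamma> g B) ` carrier \<Gamma>)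
      in \<forall>X\<in>W. \<forall>Y\<in>W. gr_mat_mult \<Gamma> X Y \<in> W)"

definition group_character :: "('g, 'm) monoid_scheme \<Rightarrow> ('g \<Rightarrow> complex) \<Rightarrow> bool" where
  "group_character \<Gamma> \<alpha> \<longleftrightarrow>
     (\<forall>x \<in> carrier \<Gamma>. cmod (\<alpha> x) = 1) \<and>
     (\<forall>x \<in> carrier \<Gamma>. \<forall>y \<in> carrier \<Gamma>. \<alpha> (x \<otimes>\<^bsub>\<Gamma>\<^esub> y) = \<alpha> x * \<alpha> y)"

definition eval_at_character ::
    "('g, 'm) monoid_scheme \<Rightarrow> ('g \<Rightarrow> complex) \<Rightarrow> ('g \<Rightarrow> complex) mat \<Rightarrow> complex mat" where
  "eval_at_character \<Gamma> \<alpha> B = map_mat (\<lambda>f. \<Sum>x \<in> carrier \<Gamma>. f x * \<alpha> x) B"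

definition cayley_lift ::
    "('g, 'm) monoid_scheme \<Rightarrow> ('g \<Rightarrow> complex) mat \<Rightarrow> nat \<times> 'g \<Rightarrow> nat \<times> 'g \<Rightarrow> complex" where
  "cayley_lift \<Gamma> B = (\<lambda>(i, g) (j, h).
     \<Sum>x \<in> carrier \<Gamma>. (B $$ (i, j)) x * (if x \<otimes>\<^bsub>\<Gamma>\<^esub> h = g then 1 else 0))"

definition roux_graph ::
    "('g, 'm) monoid_scheme \<Rightarrow> nat \<Rightarrow> ('g \<Rightarrow> complex) mat \<Rightarrow> (nat \<times> 'g) pair_pre_digraph" where
  "roux_graph \<Gamma> n B =
     \<lparr>pverts = {..<n} \<times> carrier \<Gamma>,
      parcs = {(u, v) \<in> ({..<n} \<times> carrier \<Gamma>) \<times> ({..<n} \<times> carrier \<Gamma>). cayley_lift \<Gamma> B u v = 1}\<rparr>"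

definition roux_fibres :: "('g, 'm) monoid_scheme \<Rightarrow> nat \<Rightarrow> (nat \<times> 'g) set set" where
  "roux_fibres \<Gamma> n = (\<lambda>i. {i} \<times> carrier \<Gamma>) ` {..<n}"


section \<open>Distance-regular antipodal covers of complete graphs\<close>

text \<open>Finite simple graphs are the library's \<open>pair_graph\<close>: finite, loopless, and with both
  orientations of each edge present.\<close>

definition graph_dist :: "'v pair_pre_digraph \<Rightarrow> 'v \<Rightarrow> 'v \<Rightarrow> enat" where
  "graph_dist G u v = (INF p \<in> {p. pre_digraph.awalk (with_proj G) u p v}. enat (length p))"

definition graph_diameter :: "'v pair_pre_digraph \<Rightarrow> enat" where
  "graph_diameter G = (SUP (u, v) \<in> pverts G \<times> pverts G. graph_dist G u v)"

definition distance_regular :: "'v pair_pre_digraph \<Rightarrow> bool" where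
  "distance_regular G \<longleftrightarrow>
     (\<forall>i j. \<forall>u \<in> pverts G. \<forall>v \<in> pverts G. \<forall>u' \<in> pverts G. \<forall>v' \<in> pverts G.
        graph_dist G u v = graph_dist G u' v' \<longrightarrow>
        card {w \<in> pverts G. graph_dist G u w = i \<and> graph_dist G v w = j} =
        card {w \<in> pverts G. graph_dist G u' w = i \<and> graph_dist G v' w = j})"

definition cover_of_complete_graph :: "'v pair_pre_digraph \<Rightarrow> 'v set set \<Rightarrow> bool" where
  "cover_of_complete_graph G P \<longleftrightarrow>
     pair_graph G \<and> partition_on (pverts G) P \<and>
     (\<forall>F\<in>P. \<forall>u\<in>F. \<forall>v\<in>F. (u, v) \<notin> parcs G) \<and>
     (\<forall>F\<in>P. \<forall>F'\<in>P. F \<noteq> F' \<longrightarrow>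
        (\<forall>u \<in> F \<union> F'. \<exists>!v. v \<in> F \<union> F' \<and> (u, v) \<in> parcs G))"

definition drackn :: "'v pair_pre_digraph \<Rightarrow> 'v set set \<Rightarrow> bool" where
  "drackn G P \<longleftrightarrow>
     cover_of_complete_graph G P \<and>
     Digraph_Component.connected (with_proj G) \<and>
     distance_regular G \<and>
     (\<forall>u \<in> pverts G. \<forall>v \<in> pverts G. u \<noteq> v \<longrightarrow>
        (graph_dist G u v = graph_diameter G \<longleftrightarrow> (\<exists>F\<in>P. u \<in> F \<and> v \<in> F)))"

text \<open>To write the adjacency matrix of a cover in blocks, its vertices are labelled by
  \<open>lab\<close> with pairs of a fibre index below \<open>n\<close> and a position below \<open>s\<close> in the fibre.\<close>

definition cover_labelling ::
    "'v pair_pre_digraph \<Rightarrow> 'v set set \<Rightarrow> nat \<Rightarrow> nat \<Rightarrow> (nat \<times> nat \<Rightarrow> 'v) \<Rightarrow> bool" where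
  "cover_labelling G P n s lab \<longleftrightarrow>
     bij_betw lab ({..<n} \<times> {..<s}) (pverts G) \<and>
     P = (\<lambda>i. lab ` ({i} \<times> {..<s})) ` {..<n}"

definition cover_block ::
    "'v pair_pre_digraph \<Rightarrow> nat \<Rightarrow> (nat \<times> nat \<Rightarrow> 'v) \<Rightarrow> nat \<Rightarrow> nat \<Rightarrow> int mat" where
  "cover_block G s lab i j =
     mat s s (\<lambda>(a, b). if (lab (i, a), lab (j, b)) \<in> parcs G then 1 else 0)"

definition normalizing_block ::
    "'v pair_pre_digraph \<Rightarrow> nat \<Rightarrow> (nat \<times> nat \<Rightarrow> 'v) \<Rightarrow> nat \<Rightarrow> int mat" where
  "normalizing_block G s lab j = (if j = 0 then 1\<^sub>m s else cover_block G s lab 0 j)"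

text \<open>The \<open>(i, j)\<close> block of \<open>D A D\<^sup>-\<^sup>1\<close>: the diagonal blocks of \<open>D\<close> are permutation matrices, so
  \<open>D\<^sup>-\<^sup>1\<close> is the transpose of \<open>D\<close>.\<close>

definition normalized_block ::
    "'v pair_pre_digraph \<Rightarrow> nat \<Rightarrow> (nat \<times> nat \<Rightarrow> 'v) \<Rightarrow> nat \<Rightarrow> nat \<Rightarrow> int mat" where
  "normalized_block G s lab i j =
     normalizing_block G s lab i * cover_block G s lab i j *
     transpose_mat (normalizing_block G s lab j)"

text \<open>\<open>sym_group s\<close> acts on \<open>{1..s}\<close> while matrix indices start at \<open>0\<close>, hence the shift.\<close>

definition permutation_mat :: "nat \<Rightarrow> (nat \<Rightarrow> nat) \<Rightarrow> int mat" where
  "permutation_mat s \<sigma> = mat s s (\<lambda>(a, b). if Suc a = \<sigma> (Suc b) then 1 else 0)"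

definition cover_group ::
    "'v pair_pre_digraph \<Rightarrow> nat \<Rightarrow> nat \<Rightarrow> (nat \<times> nat \<Rightarrow> 'v) \<Rightarrow> (nat \<Rightarrow> nat) set" where
  "cover_group G n s lab = generate (sym_group s)
     {\<sigma> \<in> carrier (sym_group s).
        \<exists>i<n. \<exists>j<n. i \<noteq> j \<and> normalized_block G s lab i j = permutation_mat s \<sigma>}"

text \<open>For a cover, another labelling replaces \<open>cover_group\<close> by a conjugate of it under a
  relabelling of positions, so regularity and commutativity do not depend on the labelling.\<close>

definition regular_cover :: "'v pair_pre_digraph \<Rightarrow> 'v set set \<Rightarrow> bool" where
  "regular_cover G P \<longleftrightarrow> (\<exists>n s lab. cover_labelling G P n s lab \<and>
     (\<forall>a \<in> {1..s}. \<forall>b \<in> {1..s}. \<exists>!\<sigma>. \<sigma> \<in> cover_group G n s lab \<and> \<sigma> a = b))"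

definition abelian_cover :: "'v pair_pre_digraph \<Rightarrow> 'v set set \<Rightarrow> bool" where
  "abelian_cover G P \<longleftrightarrow> (\<exists>n s lab. cover_labelling G P n s lab \<and>
     comm_group (sym_group s \<lparr>carrier := cover_group G n s lab\<rparr>))"

definition regular_abelian_drackn :: "'v pair_pre_digraph \<Rightarrow> 'v set set \<Rightarrow> bool" where
  "regular_abelian_drackn G P \<longleftrightarrow> drackn G P \<and> regular_cover G P \<and> abelian_cover G P"


section \<open>DRACKN lines\<close>

text \<open>Every finite group is isomorphic to one whose elements are natural numbers, so the
  existential over all finite abelian groups is taken over carriers in \<^typ>\<open>nat\<close>; every other
  ingredient is invariant under isomorphism.\<close>

definition drackn_lines :: "nat \<Rightarrow> nat \<Rightarrow> (nat \<Rightarrow> complex vec set) \<Rightarrow> bool" where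
  "drackn_lines d n L \<longleftrightarrow>
     linearly_dependent_lines d n L \<and>
     (\<exists>(\<Gamma> :: nat monoid) B \<alpha>.
        roux \<Gamma> n B \<and> group_character \<Gamma> \<alpha> \<and>
        regular_abelian_drackn (roux_graph \<Gamma> n B) (roux_fibres \<Gamma> n) \<and>
        lines_have_signature_matrix d n L (eval_at_character \<Gamma> \<alpha> B))"

end

(* Let b_ij be the off-diagonal entries of a roux. In the roux graph the vertices (i, g) and (j, h)
   with i ~= j have as many common neighbours as there are k with b_ik b_kj = g h^-1, so the graph is a
   DRACKN exactly when this number takes one value a if b_ij = g h^-1 and another value c > 0 otherwise.
   Summing against a nontrivial character beta turns the counts into
   beta(B)^2 = (n - 1) I + (a - c) beta(B), so beta(B) has the two roots of this quadratic as its
   spectrum; up to switching the Hadamard powers of S are such evaluations. Conversely, a Hermitian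
   matrix with spectrum {theta, tau} satisfies the quadratic with these roots, and the quadratics for all
   the powers S^k, 0 < k < r, determine the counts by Fourier inversion on Z/r; c = 0 would force all
   off-diagonal entries of the normalized S to be 1. If r = 1, the trivial character of any DRACKN roux
   on n fibres works. *)

theory Submission
  imports Defs "HOL-Algebra.Multiplicative_Group"
begin

section \<open>Hermitian matrices with two eigenvalues\<close>

text \<open>The spectrum is only a set of eigenvalues, so the quadratic has to be earned: (M -
  \<theta>)(M - \<tau>) is Hermitian and, by triangularization, nilpotent, and such a matrix is 0.
  This also covers \<theta> = \<tau>. The signature matrix in the definition of DRACKN lines may
  differ from the normalized one by a switching. Normalization lets the powers of \<open>S\<close>
  detect the character: where \<alpha>^k is trivial, the k-th Hadamard power of \<open>S\<close> has
  only ones off the diagonal, so minimality of r makes \<alpha>^k nontrivial for 0 < k < r. In the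
  forward direction the diameter is unknown, and the counts come from distance-regularity and
  antipodality. In the converse, c > 0 and a nontrivial group force diameter 3, and identities in
  the first row of the roux make the normalization of the cover trivial. The trivial group is no
  option for r = 1: its fibres are single vertices, so adjacent vertices would lie at the diameter
  in different fibres. A group of order 2 takes its place, and n > 2 makes its c = n - 2
  positive.\<close>

lemma strictly_upper_triangular_nilpotent:
  fixes U :: "'a :: semiring_1 mat"
  assumes U: "U \<in> carrier_mat n n"
    and up: "\<And>i j. i < n \<Longrightarrow> j < n \<Longrightarrow> j \<le> i \<Longrightarrow> U $$ (i, j) = 0"
  shows "U ^\<^sub>m n = 0\<^sub>m n n"
proof -
  \<comment> \<open>Every further factor \<open>U\<close> pushes the nonzero entries at least one
    diagonal further up; at exponent n no diagonal is left.\<close>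
  have "(U ^\<^sub>m k) $$ (i, j) = 0" if "i < n" "j < n" "j < i + k" for i j k
    using that
  proof (induction k arbitrary: j)
    case 0
    then show ?case using U by auto
  next
    case (Suc k)
    have Uk: "U ^\<^sub>m k \<in> carrier_mat n n" using U by simp
    have "(U ^\<^sub>m Suc k) $$ (i, j) = (\<Sum>l = 0..<n. (U ^\<^sub>m k) $$ (i, l) * U $$ (l, j))"
      using Suc.prems U Uk by (simp add: scalar_prod_def)
    also have "\<dots> = 0"
    proof (intro sum.neutral ballI)
      fix l assume "l \<in> {0..<n}"
      then show "(U ^\<^sub>m k) $$ (i, l) * U $$ (l, j) = 0"
        using Suc.IH[of l] Suc.prems up[of l j] by (cases "l < i + k") auto
    qed
    finally show ?case .
  qed
  then show ?thesis using U by (intro eq_matI) auto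
qed

definition hermitian_mat :: "nat \<Rightarrow> complex mat \<Rightarrow> bool" where
  "hermitian_mat n M \<longleftrightarrow> M \<in> carrier_mat n n \<and> (\<forall>i<n. \<forall>j<n. M $$ (j, i) = cnj (M $$ (i, j)))"

lemma hermitian_matD:
  assumes "hermitian_mat n M"
  shows "M \<in> carrier_mat n n" "i < n \<Longrightarrow> j < n \<Longrightarrow> cnj (M $$ (i, j)) = M $$ (j, i)"
  using assms unfolding hermitian_mat_def by metis+

text \<open>The i-th diagonal entry of \<open>H * H\<close> is the sum of the squared moduli of row
  i, so it vanishes only with the whole row.\<close>

lemma hermitian_mat_square_eq_0:
  assumes H: "hermitian_mat n H" and sq: "H * H = 0\<^sub>m n n"
  shows "H = 0\<^sub>m n n"
proof (rule eq_matI)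
  show "dim_row H = dim_row (0\<^sub>m n n)" "dim_col H = dim_col (0\<^sub>m n n)"
    using H by (auto simp: hermitian_mat_def)
  fix i j assume "i < dim_row (0\<^sub>m n n)" "j < dim_col (0\<^sub>m n n)"
  then have ij: "i < n" "j < n" by auto
  have C: "H \<in> carrier_mat n n" using H by (simp add: hermitian_mat_def)
  have "0 = (H * H) $$ (i, i)" using ij sq by simp
  also have "\<dots> = (\<Sum>l = 0..<n. H $$ (i, l) * H $$ (l, i))"
    using ij C by (simp add: scalar_prod_def)
  also have "\<dots> = (\<Sum>l = 0..<n. complex_of_real ((cmod (H $$ (i, l)))\<^sup>2))"
  proof (intro sum.cong refl)
    fix l assume "l \<in> {0..<n}"
    then show "H $$ (i, l) * H $$ (l, i) = complex_of_real ((cmod (H $$ (i, l)))\<^sup>2)"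
      using ij hermitian_matD(2)[OF H, of i l] complex_norm_square by (metis atLeastLessThan_iff)
  qed
  finally have "(\<Sum>l = 0..<n. (cmod (H $$ (i, l)))\<^sup>2) = 0"
    by (metis of_real_eq_0_iff of_real_sum)
  then have "\<forall>l\<in>{0..<n}. (cmod (H $$ (i, l)))\<^sup>2 = 0"
    by (subst (asm) sum_nonneg_eq_0_iff) auto
  then show "H $$ (i, j) = 0\<^sub>m n n $$ (i, j)" using ij by auto
qed

lemma hermitian_mat_mult_self:
  assumes "hermitian_mat n H"
  shows "hermitian_mat n (H * H)"
proof -
  have C: "H \<in> carrier_mat n n" using assms by (simp add: hermitian_mat_def)
  have "(H * H) $$ (j, i) = cnj ((H * H) $$ (i, j))" if "i < n" "j < n" for i j
  proof -
    have "(H * H) $$ (j, i) = (\<Sum>l = 0..<n. H $$ (j, l) * H $$ (l, i))"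
      using that C by (simp add: scalar_prod_def)
    also have "\<dots> = (\<Sum>l = 0..<n. cnj (H $$ (i, l) * H $$ (l, j)))"
      using that by (intro sum.cong refl) (simp add: hermitian_matD(2)[OF assms])
    also have "\<dots> = cnj ((H * H) $$ (i, j))"
      using that C by (simp add: scalar_prod_def)
    finally show ?thesis .
  qed
  then show ?thesis using C unfolding hermitian_mat_def by (metis mult_carrier_mat)
qed

lemma pow_mat_add:
  assumes "A \<in> carrier_mat n n"
  shows "A ^\<^sub>m (k + l) = A ^\<^sub>m k * (A ^\<^sub>m l :: 'a :: semiring_1 mat)"
proof (induction l)
  case 0
  then show ?case using assms by simp
next
  case (Suc l)
  have "A ^\<^sub>m k \<in> carrier_mat n n" "A ^\<^sub>m l \<in> carrier_mat n n" using assms by auto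
  then show ?case using Suc assms by (simp add: assoc_mult_mat[of _ n n _ n _ n] mult_carrier_mat[of _ n n _ n])
qed

text \<open>Squaring stays among Hermitian matrices, so a vanishing power with exponent 2^m can be
  halved step by step down to \<open>H\<close> itself.\<close>

lemma hermitian_mat_nilpotent:
  assumes H: "hermitian_mat n H" and nil: "H ^\<^sub>m k = 0\<^sub>m n n"
  shows "H = 0\<^sub>m n n"
proof -
  have C: "H \<in> carrier_mat n n" using H by (simp add: hermitian_mat_def)
  have pow: "hermitian_mat n (H ^\<^sub>m (2 ^ m))" for m
  proof (induction m)
    case 0
    then show ?case using H C by simp
  next
    case (Suc m)
    have "H ^\<^sub>m (2 ^ Suc m) = H ^\<^sub>m (2 ^ m) * H ^\<^sub>m (2 ^ m)"
      using pow_mat_add[OF C, of "2 ^ m" "2 ^ m"] by (simp add: mult_2)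
    then show ?case using hermitian_mat_mult_self[OF Suc] by simp
  qed
  have desc: "H ^\<^sub>m (2 ^ m) = 0\<^sub>m n n \<Longrightarrow> H = 0\<^sub>m n n" for m
  proof (induction m)
    case 0
    then show ?case using C by simp
  next
    case (Suc m)
    have "H ^\<^sub>m (2 ^ Suc m) = H ^\<^sub>m (2 ^ m) * H ^\<^sub>m (2 ^ m)"
      using pow_mat_add[OF C, of "2 ^ m" "2 ^ m"] by (simp add: mult_2)
    then show ?case using Suc hermitian_mat_square_eq_0[OF pow] by simp
  qed
  \<comment> \<open>The exponent k is first raised to a power of two, using k \<le> 2^k.\<close>
  have "H ^\<^sub>m (2 ^ k) = H ^\<^sub>m k * H ^\<^sub>m (2 ^ k - k)"
    using pow_mat_add[OF C, of k "2 ^ k - k"] by (simp add: less_imp_le)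
  also have "\<dots> = 0\<^sub>m n n" using nil C by simp
  finally show ?thesis by (rule desc)
qed

text \<open>The form \<open>Q\<close> of an eigenvector equals e times its squared norm
  \<open>N\<close>, and both are their own conjugates. Real eigenvalues keep the coefficients of (M
  - \<theta>)(M - \<tau>) self-conjugate.\<close>

lemma hermitian_mat_eigenvalue_real:
  assumes H: "hermitian_mat n H" and ev: "eigenvalue H e"
  shows "cnj e = e"
proof -
  have C: "H \<in> carrier_mat n n" using H by (simp add: hermitian_mat_def)
  obtain v where v: "v \<in> carrier_vec n" "v \<noteq> 0\<^sub>v n" "H *\<^sub>v v = e \<cdot>\<^sub>v v"
    using ev C by (auto simp: eigenvalue_def eigenvector_def)
  have row: "(\<Sum>l = 0..<n. H $$ (i, l) * v $ l) = e * v $ i" if "i < n" for i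
  proof -
    have "(H *\<^sub>v v) $ i = (\<Sum>l = 0..<n. H $$ (i, l) * v $ l)"
      using that C v(1) by (simp add: scalar_prod_def)
    then show ?thesis using v that by simp
  qed
  define N where "N = (\<Sum>i = 0..<n. v $ i * cnj (v $ i))"
  define Q where "Q = (\<Sum>i = 0..<n. \<Sum>l = 0..<n. cnj (v $ i) * H $$ (i, l) * v $ l)"
  have "Q = (\<Sum>i = 0..<n. cnj (v $ i) * (\<Sum>l = 0..<n. H $$ (i, l) * v $ l))"
    unfolding Q_def by (simp add: sum_distrib_left mult.assoc)
  also have "\<dots> = (\<Sum>i = 0..<n. cnj (v $ i) * (e * v $ i))"
    by (intro sum.cong) (auto simp: row)
  also have "\<dots> = e * N" unfolding N_def by (simp add: sum_distrib_left mult_ac)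
  finally have Q: "Q = e * N" .
  have "cnj Q = (\<Sum>i = 0..<n. \<Sum>l = 0..<n. v $ i * cnj (H $$ (i, l)) * cnj (v $ l))"
    unfolding Q_def by simp
  also have "\<dots> = (\<Sum>i = 0..<n. \<Sum>l = 0..<n. v $ i * H $$ (l, i) * cnj (v $ l))"
    by (intro sum.cong refl) (simp add: hermitian_matD(2)[OF H])
  also have "\<dots> = Q"
    unfolding Q_def by (subst sum.swap) (simp add: mult_ac)
  finally have "cnj Q = Q" .
  moreover have "cnj N = N" unfolding N_def by (simp add: mult.commute)
  ultimately have "cnj e * N = e * N" using Q by (metis complex_cnj_mult)
  moreover have "N \<noteq> 0"
  proof
    assume "N = 0"
    moreover have "N = complex_of_real (\<Sum>i = 0..<n. (cmod (v $ i))\<^sup>2)"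
      unfolding N_def of_real_sum complex_norm_square ..
    ultimately have "(\<Sum>i = 0..<n. (cmod (v $ i))\<^sup>2) = 0" by (metis of_real_eq_0_iff)
    then have "\<forall>i\<in>{0..<n}. (cmod (v $ i))\<^sup>2 = 0"
      by (subst (asm) sum_nonneg_eq_0_iff) auto
    then have "v = 0\<^sub>v n" using v(1) by (intro eq_vecI) auto
    then show False using v(2) by simp
  qed
  ultimately show ?thesis by simp
qed

text \<open>The entrywise form is chosen because the counts of group elements will enter through the
  entries of the square of \<open>M\<close>.\<close>

lemma shifted_mat_mult_entry:
  fixes M :: "'a :: comm_ring_1 mat"
  assumes M: "M \<in> carrier_mat n n" and kl: "k < n" "l < n"
  shows "((M - x \<cdot>\<^sub>m 1\<^sub>m n) * (M - y \<cdot>\<^sub>m 1\<^sub>m n)) $$ (k, l) =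
    (\<Sum>m<n. M $$ (k, m) * M $$ (m, l)) - (x + y) * M $$ (k, l) + (if k = l then x * y else 0)"
proof -
  have "((M - x \<cdot>\<^sub>m 1\<^sub>m n) * (M - y \<cdot>\<^sub>m 1\<^sub>m n)) $$ (k, l) =
    (\<Sum>m<n. (M $$ (k, m) - (if m = k then x else 0)) * (M $$ (m, l) - (if m = l then y else 0)))"
    using M kl by (auto simp: scalar_prod_def atLeast0LessThan intro!: sum.cong)
  also have "\<dots> = (\<Sum>m<n. M $$ (k, m) * M $$ (m, l) - (if m = l then y * M $$ (k, l) else 0) -
      (if m = k then x * M $$ (k, l) else 0) + (if m = k then (if k = l then x * y else 0) else 0))"
    by (intro sum.cong) (auto simp: algebra_simps)
  also have "\<dots> = (\<Sum>m<n. M $$ (k, m) * M $$ (m, l)) - (x + y) * M $$ (k, l) +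
      (if k = l then x * y else 0)"
    using kl by (simp add: sum.distrib sum_subtractf algebra_simps)
  finally show ?thesis .
qed

lemma mult_mat_entry:
  assumes "A \<in> carrier_mat n n" "B \<in> carrier_mat n n" "i < n" "j < n"
  shows "(A * B) $$ (i, j) = (\<Sum>l<n. A $$ (i, l) * B $$ (l, j))"
  using assms by (simp add: scalar_prod_def atLeast0LessThan)

text \<open>In a Schur form \<open>T\<close> of \<open>M\<close> every diagonal entry is killed by
  one of the two shifts, so (T - \<theta>)(T - \<tau>) is strictly upper triangular. Hence (M -
  \<theta>)(M - \<tau>) is nilpotent; being Hermitian, it is 0.\<close>

lemma hermitian_mat_two_eigenvalues:
  assumes M: "hermitian_mat n M" and sp: "spectrum M = {\<theta>, \<tau>}" and ij: "i < n" "j < n"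
  shows "(\<Sum>l<n. M $$ (i, l) * M $$ (l, j)) =
    (\<theta> + \<tau>) * M $$ (i, j) - (if i = j then \<theta> * \<tau> else 0)"
proof -
  have C: "M \<in> carrier_mat n n" using M by (simp add: hermitian_mat_def)
  have real: "cnj \<theta> = \<theta>" "cnj \<tau> = \<tau>"
    using sp hermitian_mat_eigenvalue_real[OF M] by (auto simp: spectrum_def)
  obtain es where es: "char_poly M = (\<Prod>e\<leftarrow>es. [:- e, 1:])"
    using char_poly_factorized[OF C] by blast
  obtain T P Q where sd: "schur_decomposition M es = (T, P, Q)" by (cases "schur_decomposition M es")
  have wit: "similar_mat_wit M T P Q" and up: "upper_triangular T" and dT: "diag_mat T = es"
    using schur_decomposition[OF C es sd] by auto
  note W = similar_mat_witD2[OF C wit]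
  have diag: "T $$ (l, l) = \<theta> \<or> T $$ (l, l) = \<tau>" if "l < n" for l
  proof -
    have "T $$ (l, l) \<in> set es" using that W dT by (auto simp: diag_mat_def)
    then have "poly (char_poly M) (T $$ (l, l)) = 0"
      unfolding es by (simp add: poly_prod_list_zero_iff)
    then show ?thesis using sp spectrum_root_char_poly[OF C] by auto
  qed
  define f where "f x A = A - x \<cdot>\<^sub>m 1\<^sub>m n" for x :: complex and A
  have fM: "f x M = P * f x T * Q" for x
  proof -
    have "P * f x T * Q = P * T * Q - P * (x \<cdot>\<^sub>m 1\<^sub>m n) * Q"
      using W unfolding f_def
      by (simp add: mult_minus_distrib_mat[of _ n n _ n] minus_mult_distrib_mat[of _ n n _ _ n])
    also have "P * (x \<cdot>\<^sub>m 1\<^sub>m n) * Q = x \<cdot>\<^sub>m 1\<^sub>m n"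
      using W by (simp add: mult_smult_distrib[of _ n n _ n] mult_smult_assoc_mat[of _ n n _ n])
    finally show ?thesis using W unfolding f_def by simp
  qed
  have fc: "f x M \<in> carrier_mat n n" "f x T \<in> carrier_mat n n" for x
    using C W unfolding f_def by auto
  define U where "U = f \<theta> T * f \<tau> T"
  define H where "H = f \<theta> M * f \<tau> M"
  have UH: "U \<in> carrier_mat n n" "H \<in> carrier_mat n n" using fc unfolding U_def H_def by (auto intro!: mult_carrier_mat)
  have "H = P * U * Q"
  proof -
    have "H = P * f \<theta> T * Q * (P * f \<tau> T * Q)" unfolding H_def fM ..
    also have "\<dots> = P * f \<theta> T * (Q * P) * f \<tau> T * Q"
      using W(4-7) fc(2) by (simp add: assoc_mult_mat[of _ n n _ n _ n] mult_carrier_mat[of _ n n _ n])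
    also have "\<dots> = P * U * Q"
      using W(2,4-7) fc(2) unfolding U_def
      by (simp add: assoc_mult_mat[of _ n n _ n _ n] mult_carrier_mat[of _ n n _ n]
          left_mult_one_mat[of _ n n])
    finally show ?thesis .
  qed
  then have sim: "similar_mat_wit H U P Q"
    using W UH by (intro similar_mat_witI) auto
  have "U ^\<^sub>m n = 0\<^sub>m n n"
  proof (rule strictly_upper_triangular_nilpotent[OF UH(1)])
    fix i j assume ij: "i < n" "j < n" "j \<le> i"
    have ent: "f x T $$ (k, l) = (if l < k then 0 else if k = l then T $$ (k, k) - x else T $$ (k, l))"
      if "k < n" "l < n" for k l x
      using that W up unfolding f_def by (auto simp: upper_triangular_def)
    have "U $$ (i, j) = (\<Sum>l<n. f \<theta> T $$ (i, l) * f \<tau> T $$ (l, j))"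
      unfolding U_def by (rule mult_mat_entry[OF fc(2) fc(2) ij(1,2)])
    also have "\<dots> = 0"
      using ij diag[of i] by (intro sum.neutral ballI) (auto simp: ent)
    finally show "U $$ (i, j) = 0" .
  qed
  then have "H ^\<^sub>m n = 0\<^sub>m n n" using similar_mat_wit_pow_id[OF sim, of n] W by simp
  moreover have Hent: "H $$ (k, l) = (\<Sum>m<n. M $$ (k, m) * M $$ (m, l)) -
      (\<theta> + \<tau>) * M $$ (k, l) + (if k = l then \<theta> * \<tau> else 0)" if "k < n" "l < n" for k l
    unfolding H_def f_def using shifted_mat_mult_entry[OF C that] .
  moreover have "hermitian_mat n H"
  proof -
    have "H $$ (l, k) = cnj (H $$ (k, l))" if kl: "k < n" "l < n" for k l
    proof -
      have "cnj (\<Sum>m<n. M $$ (k, m) * M $$ (m, l)) = (\<Sum>m<n. M $$ (l, m) * M $$ (m, k))"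
        unfolding cnj_sum using kl
        by (auto simp: hermitian_matD(2)[OF M] mult.commute intro!: sum.cong)
      moreover have "cnj (M $$ (k, l)) = M $$ (l, k)" by (rule hermitian_matD(2)[OF M kl])
      moreover have "cnj (if k = l then \<theta> * \<tau> else 0) = (if l = k then \<theta> * \<tau> else 0)"
        by (auto simp: real)
      ultimately show ?thesis
        unfolding Hent[OF kl] Hent[OF kl(2,1)]
        by (simp only: complex_cnj_add complex_cnj_diff complex_cnj_mult real)
    qed
    then show ?thesis using UH(2) unfolding hermitian_mat_def by blast
  qed
  ultimately have "H = 0\<^sub>m n n" using hermitian_mat_nilpotent by blast
  then show ?thesis using Hent[OF ij] ij by (simp add: algebra_simps)
qed

text \<open>The quadratic alone only confines the spectrum to {\<theta>, \<tau>}. Both values occur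
  because M - x sends column j of M - y to 0, and this column is not zero: its entry in row i is
  \<open>M $$ (i, j)\<close>, which the shift leaves untouched as i \<noteq> j.\<close>

lemma spectrum_of_quadratic:
  fixes M :: "complex mat"
  assumes M: "M \<in> carrier_mat n n" and ij: "i < n" "j < n" "i \<noteq> j" "M $$ (i, j) \<noteq> 0"
    and sq: "\<And>k l. k < n \<Longrightarrow> l < n \<Longrightarrow> (\<Sum>m<n. M $$ (k, m) * M $$ (m, l)) =
      (\<theta> + \<tau>) * M $$ (k, l) - (if k = l then \<theta> * \<tau> else 0)"
  shows "spectrum M = {\<theta>, \<tau>}"
proof -
  define f where "f x = M - x \<cdot>\<^sub>m 1\<^sub>m n" for x :: complex
  have f: "f x \<in> carrier_mat n n" for x using M unfolding f_def by auto
  have fv: "f x *\<^sub>v w = M *\<^sub>v w - x \<cdot>\<^sub>v w" if "w \<in> carrier_vec n" for x w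
  proof (rule eq_vecI)
    fix k assume "k < dim_vec (M *\<^sub>v w - x \<cdot>\<^sub>v w)"
    then have k: "k < n" using that by simp
    have "(f x *\<^sub>v w) $ k = (\<Sum>l<n. M $$ (k, l) * w $ l - (if l = k then x * w $ k else 0))"
      using k M that unfolding f_def
      by (auto simp: scalar_prod_def atLeast0LessThan algebra_simps simp flip: sum_subtractf
          intro!: sum.cong)
    then show "(f x *\<^sub>v w) $ k = (M *\<^sub>v w - x \<cdot>\<^sub>v w) $ k"
      using k M that by (simp add: sum_subtractf scalar_prod_def atLeast0LessThan)
  qed (use f M that in auto)
  \<comment> \<open>Stated for the unordered pair, so that \<theta> and \<tau> can exchange places
    when the eigenvectors are built.\<close>
  have prod: "f x * f y = 0\<^sub>m n n" if "{x, y} = {\<theta>, \<tau>}" "x + y = \<theta> + \<tau>" for x y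
  proof (rule eq_matI)
    fix k l assume "k < dim_row (0\<^sub>m n n)" "l < dim_col (0\<^sub>m n n)"
    then have kl: "k < n" "l < n" by auto
    have xy: "x * y = \<theta> * \<tau>" using that by (auto simp: doubleton_eq_iff)
    have "(f x * f y) $$ (k, l) = (\<Sum>m<n. M $$ (k, m) * M $$ (m, l)) -
        (x + y) * M $$ (k, l) + (if k = l then x * y else 0)"
      unfolding f_def using shifted_mat_mult_entry[OF M kl] .
    then show "(f x * f y) $$ (k, l) = 0\<^sub>m n n $$ (k, l)" using kl sq[OF kl] that(2) xy by simp
  qed (use f in auto)
  have eig: "eigenvalue M x" if "{x, y} = {\<theta>, \<tau>}" "x + y = \<theta> + \<tau>" for x y
  proof -
    define v where "v = col (f y) j"
    have v: "v \<in> carrier_vec n" using f[of y] unfolding v_def by auto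
    have "v $ i \<noteq> 0" using ij M unfolding v_def f_def by simp
    then have v0: "v \<noteq> 0\<^sub>v n" using ij by auto
    have "f x *\<^sub>v v = col (f x * f y) j"
      unfolding v_def using f ij by (subst col_mult2[of _ n n _ n]) auto
    also have "\<dots> = 0\<^sub>v n" using ij by (simp add: prod[OF that])
    finally have "M *\<^sub>v v - x \<cdot>\<^sub>v v = 0\<^sub>v n"
      by (simp add: fv[OF v])
    then have "(M *\<^sub>v v - x \<cdot>\<^sub>v v) $ l = 0" if "l < n" for l using that by simp
    then have "M *\<^sub>v v = x \<cdot>\<^sub>v v"
      using M v by (intro eq_vecI) fastforce+
    then show ?thesis using M v v0 by (auto simp: eigenvalue_def eigenvector_def)
  qed
  have "x \<in> {\<theta>, \<tau>}" if ev: "eigenvalue M x" for x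
  proof -
    obtain v where v: "v \<in> carrier_vec n" "v \<noteq> 0\<^sub>v n" "M *\<^sub>v v = x \<cdot>\<^sub>v v"
      using ev M by (auto simp: eigenvalue_def eigenvector_def)
    have fv': "f y *\<^sub>v v = (x - y) \<cdot>\<^sub>v v" for y
      unfolding fv[OF v(1)] v(3) using v(1) by (intro eq_vecI) (auto simp: algebra_simps)
    have "0\<^sub>v n = f \<theta> * f \<tau> *\<^sub>v v"
      using v(1) by (intro eq_vecI) (auto simp: prod[of \<theta> \<tau>])
    also have "\<dots> = f \<theta> *\<^sub>v (f \<tau> *\<^sub>v v)"
      using f v(1) by (intro assoc_mult_mat_vec[of _ n n _ n]) auto
    also have "\<dots> = (x - \<tau>) \<cdot>\<^sub>v (f \<theta> *\<^sub>v v)"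
      unfolding fv'[of \<tau>] using f v(1) by (simp add: mult_mat_vec[of _ n n])
    also have "\<dots> = ((x - \<tau>) * (x - \<theta>)) \<cdot>\<^sub>v v" unfolding fv' by (simp add: smult_smult_assoc)
    finally have *: "((x - \<tau>) * (x - \<theta>)) \<cdot>\<^sub>v v = 0\<^sub>v n" ..
    obtain l where l: "l < n" "v $ l \<noteq> 0" using v by (metis carrier_vecD eq_vecI index_zero_vec(1) index_zero_vec(2))
    have "(x - \<tau>) * (x - \<theta>) * v $ l = (((x - \<tau>) * (x - \<theta>)) \<cdot>\<^sub>v v) $ l"
      using l v by simp
    then show ?thesis using l unfolding * by auto
  qed
  moreover have "eigenvalue M \<theta>" "eigenvalue M \<tau>" using eig[of \<theta> \<tau>] eig[of \<tau> \<theta>] by auto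
  ultimately show ?thesis by (auto simp: spectrum_def)
qed

section \<open>Roux graphs and common neighbours\<close>

lemma awalk_with_proj_Nil: "pre_digraph.awalk (with_proj G) u [] v \<longleftrightarrow> u \<in> pverts G \<and> u = v"
  by (simp add: pre_digraph.awalk_def cas_with_proj_eq)

lemma (in pair_wf_digraph) awalk_with_proj_Cons:
  "pre_digraph.awalk (with_proj G) u (e # p) v \<longleftrightarrow>
    e \<in> parcs G \<and> fst e = u \<and> pre_digraph.awalk (with_proj G) (snd e) p v"
  by (auto simp: pre_digraph.awalk_def cas_with_proj_eq arc_fst_in_verts arc_snd_in_verts)

text \<open>A nonempty set of \<open>enat\<close> has a least element, so a finite infimum is the
  length of an actual walk; without walks the infimum is infinite.\<close>

lemma graph_dist_le_iff:
  "graph_dist G u v \<le> enat k \<longleftrightarrow> (\<exists>p. pre_digraph.awalk (with_proj G) u p v \<and> length p \<le> k)"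
proof
  define A where "A = (\<lambda>p. enat (length p)) ` {p. pre_digraph.awalk (with_proj G) u p v}"
  assume "graph_dist G u v \<le> enat k"
  then have le: "Inf A \<le> enat k" unfolding graph_dist_def A_def .
  then have "A \<noteq> {}" by (auto simp: top_enat_def)
  then have "Inf A \<in> A" by (metis ex_in_conv wellorder_InfI)
  then show "\<exists>p. pre_digraph.awalk (with_proj G) u p v \<and> length p \<le> k"
    using le unfolding A_def by auto
next
  assume "\<exists>p. pre_digraph.awalk (with_proj G) u p v \<and> length p \<le> k"
  then obtain p where p: "pre_digraph.awalk (with_proj G) u p v" "length p \<le> k" by blast
  have "graph_dist G u v \<le> enat (length p)"
    unfolding graph_dist_def using p(1) by (intro INF_lower) auto
  then show "graph_dist G u v \<le> enat k" using p(2) by (meson enat_ord_simps(1) order_trans)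
qed

lemma graph_dist_le_0_iff: "graph_dist G u v \<le> 0 \<longleftrightarrow> u \<in> pverts G \<and> u = v"
  unfolding zero_enat_def graph_dist_le_iff by (auto simp: awalk_with_proj_Nil)

text \<open>Splitting off the first arc gives a recursion that later computes all distances up to 3
  from adjacency alone.\<close>

lemma (in pair_wf_digraph) graph_dist_le_Suc_iff:
  "graph_dist G u v \<le> enat (Suc k) \<longleftrightarrow>
    (u \<in> pverts G \<and> u = v) \<or> (\<exists>w. (u, w) \<in> parcs G \<and> graph_dist G w v \<le> enat k)"
proof
  assume "graph_dist G u v \<le> enat (Suc k)"
  then obtain p where p: "pre_digraph.awalk (with_proj G) u p v" "length p \<le> Suc k"
    unfolding graph_dist_le_iff by blast
  show "(u \<in> pverts G \<and> u = v) \<or> (\<exists>w. (u, w) \<in> parcs G \<and> graph_dist G w v \<le> enat k)"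
  proof (cases p)
    case Nil
    then show ?thesis using p awalk_with_proj_Nil[of G u v] by blast
  next
    case (Cons e q)
    then have "(u, snd e) \<in> parcs G" "graph_dist G (snd e) v \<le> enat k"
      using p unfolding graph_dist_le_iff by (auto simp: awalk_with_proj_Cons)
    then show ?thesis by blast
  qed
next
  assume *: "(u \<in> pverts G \<and> u = v) \<or> (\<exists>w. (u, w) \<in> parcs G \<and> graph_dist G w v \<le> enat k)"
  show "graph_dist G u v \<le> enat (Suc k)"
  proof (cases "u \<in> pverts G \<and> u = v")
    case True
    then have "graph_dist G u v = 0" using graph_dist_le_0_iff[of G u v] by auto
    then show ?thesis by simp
  next
    case False
    then obtain w p where "(u, w) \<in> parcs G" "pre_digraph.awalk (with_proj G) w p v" "length p \<le> k"
      using * unfolding graph_dist_le_iff by blast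
    then show ?thesis
      unfolding graph_dist_le_iff
      by (intro exI[of _ "(u, w) # p"]) (simp add: awalk_with_proj_Cons)
  qed
qed

lemma (in pair_wf_digraph) graph_dist_arc_le:
  assumes "(u, w) \<in> parcs G"
  shows "graph_dist G u v \<le> eSuc (graph_dist G w v)"
proof (cases "graph_dist G w v")
  case (enat k)
  then show ?thesis using assms graph_dist_le_Suc_iff[of u v k] by (auto simp: eSuc_enat)
qed auto

lemma (in pair_loopfree_digraph) graph_dist_eq_1_iff:
  "graph_dist G u v = 1 \<longleftrightarrow> (u, v) \<in> parcs G"
proof -
  have "graph_dist G u v = 1 \<longleftrightarrow> graph_dist G u v \<le> enat (Suc 0) \<and> \<not> graph_dist G u v \<le> 0"
    by (cases "graph_dist G u v") (auto simp: one_enat_def zero_enat_def)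
  also have "\<dots> \<longleftrightarrow> (u, v) \<in> parcs G"
    unfolding graph_dist_le_Suc_iff zero_enat_def[symmetric] graph_dist_le_0_iff
    using pair_no_loops[of "(u, v)"] in_arcsD2[of u v] by auto
  finally show ?thesis .
qed

section \<open>Roux described by group elements, and their graphs\<close>

lemma gr_of_eq_iff: "gr_of x = gr_of y \<longleftrightarrow> x = y"
  by (metis gr_of_def zero_neq_one)

text \<open>Together with \<open>rmat\<close> this expresses (R1) to (R3) through group elements
  \<open>b i j\<close>; the values \<open>b i i\<close> stay open. Condition (R4) is kept apart,
  since for an array built from a signature matrix it has to be derived from the counts.\<close>

locale roux_array = comm_group \<Gamma> for \<Gamma> :: "('g, 'm) monoid_scheme" (structure) +
  fixes n :: nat and b :: "nat \<Rightarrow> nat \<Rightarrow> 'g"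
  assumes finite_carrier: "finite (carrier \<Gamma>)"
    and b_closed: "\<lbrakk>i < n; j < n; i \<noteq> j\<rbrakk> \<Longrightarrow> b i j \<in> carrier \<Gamma>"
    and b_inverse: "\<lbrakk>i < n; j < n; i \<noteq> j\<rbrakk> \<Longrightarrow> b j i = inv (b i j)"
begin

definition rmat :: "('g \<Rightarrow> complex) mat" where
  "rmat = mat n n (\<lambda>(i, j). if i = j then (\<lambda>_. 0) else gr_of (b i j))"

abbreviation rgraph :: "(nat \<times> 'g) pair_pre_digraph" where
  "rgraph \<equiv> roux_graph \<Gamma> n rmat"

lemma b_swap: "\<lbrakk>i < n; j < n; i \<noteq> j; g \<in> carrier \<Gamma>; h \<in> carrier \<Gamma>\<rbrakk> \<Longrightarrow>
    g = b i j \<otimes> h \<longleftrightarrow> h = b j i \<otimes> g"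
  using b_closed b_inverse inv_solve_left inv_solve_left' by metis

lemma rmat_index: "\<lbrakk>i < n; j < n\<rbrakk> \<Longrightarrow>
    rmat $$ (i, j) = (if i = j then (\<lambda>_. 0) else gr_of (b i j))"
  by (simp add: rmat_def)

lemma sum_gr_of:
  "y \<in> carrier \<Gamma> \<Longrightarrow> (\<Sum>x\<in>carrier \<Gamma>. gr_of y x * f x) = f y"
proof -
  assume y: "y \<in> carrier \<Gamma>"
  have "(\<Sum>x\<in>carrier \<Gamma>. gr_of y x * f x) = (\<Sum>x\<in>carrier \<Gamma>. if x = y then f y else 0)"
    by (intro sum.cong) (auto simp: gr_of_def)
  then show ?thesis using y finite_carrier by simp
qed

lemma pverts_rgraph: "pverts rgraph = {..<n} \<times> carrier \<Gamma>"
  by (simp add: roux_graph_def)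

lemma parcs_rgraph:
  "((i, g), (j, h)) \<in> parcs rgraph \<longleftrightarrow>
    i < n \<and> j < n \<and> i \<noteq> j \<and> g \<in> carrier \<Gamma> \<and> h \<in> carrier \<Gamma> \<and> g = b i j \<otimes> h"
  by (auto simp: roux_graph_def cayley_lift_def rmat_index sum_gr_of b_closed split: if_splits)

lemma eval_rmat_index:
  assumes "i < n" "j < n"
  shows "eval_at_character \<Gamma> \<alpha> rmat $$ (i, j) = (if i = j then 0 else \<alpha> (b i j))"
  using assms by (auto simp: eval_at_character_def rmat_def sum_gr_of b_closed)

lemma pair_graph_rgraph: "pair_graph rgraph"
proof
  show "fst e \<in> pverts rgraph" "snd e \<in> pverts rgraph" if "e \<in> parcs rgraph" for e
    using that by (auto simp: roux_graph_def)
  show "finite (pverts rgraph)" using finite_carrier by (simp add: pverts_rgraph)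
  show "finite (parcs rgraph)"
    by (rule finite_subset[of _ "pverts rgraph \<times> pverts rgraph"])
      (use finite_carrier in \<open>auto simp: roux_graph_def\<close>)
  show "fst e \<noteq> snd e" if "e \<in> parcs rgraph" for e
    using that parcs_rgraph by (metis prod.collapse)
  have "(v, u) \<in> parcs rgraph" if "(u, v) \<in> parcs rgraph" for u v
    using that parcs_rgraph b_swap by (cases u; cases v) metis
  then show "symmetric rgraph"
    by (auto simp: symmetric_def intro: symI)
qed

sublocale rg: pair_graph rgraph by (rule pair_graph_rgraph)

text \<open>For \<open>x\<close> in the group, \<open>card (middle i j x)\<close> is the coefficient
  of \<open>x\<close> in the \<open>(i, j)\<close> entry of the square of
  \<open>rmat\<close>.\<close>

definition middle :: "nat \<Rightarrow> nat \<Rightarrow> 'g \<Rightarrow> nat set" where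
  "middle i j x = {k. k < n \<and> k \<noteq> i \<and> k \<noteq> j \<and> b i k \<otimes> b k j = x}"

text \<open>A common neighbour \<open>(k, t)\<close> is determined by k, since adjacency to
  \<open>(j, h)\<close> forces t = b k j \<otimes> h; adjacency to \<open>(i, g)\<close> then
  becomes the condition on k in \<open>middle\<close>.\<close>

lemma common_neighbours:
  assumes "i < n" "j < n" "g \<in> carrier \<Gamma>" "h \<in> carrier \<Gamma>"
  shows "card {w. ((i, g), w) \<in> parcs rgraph \<and> ((j, h), w) \<in> parcs rgraph} =
    card (middle i j (g \<otimes> inv h))"
proof -
  have *: "g = b i k \<otimes> t \<and> h = b j k \<otimes> t \<longleftrightarrow> t = b k j \<otimes> h \<and> b i k \<otimes> b k j = g \<otimes> inv h"
    if "k < n" "k \<noteq> i" "k \<noteq> j" "t \<in> carrier \<Gamma>" for k t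
  proof -
    have c: "b i k \<in> carrier \<Gamma>" "b k j \<in> carrier \<Gamma>" using that assms b_closed by auto
    have "h = b j k \<otimes> t \<longleftrightarrow> t = b k j \<otimes> h" using that assms b_swap by metis
    moreover have "g = b i k \<otimes> (b k j \<otimes> h) \<longleftrightarrow> b i k \<otimes> b k j = g \<otimes> inv h"
      using c assms inv_solve_right[of "b i k \<otimes> b k j" g h] by (auto simp: m_assoc)
    ultimately show ?thesis by metis
  qed
  have inj: "inj_on (\<lambda>k. (k, b k j \<otimes> h)) (middle i j (g \<otimes> inv h))" by (simp add: inj_on_def)
  have "w \<in> (\<lambda>k. (k, b k j \<otimes> h)) ` middle i j (g \<otimes> inv h) \<longleftrightarrow>
      ((i, g), w) \<in> parcs rgraph \<and> ((j, h), w) \<in> parcs rgraph" for w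
  proof -
    obtain k t where w: "w = (k, t)" by (cases w)
    have "((i, g), w) \<in> parcs rgraph \<and> ((j, h), w) \<in> parcs rgraph \<longleftrightarrow>
        k < n \<and> k \<noteq> i \<and> k \<noteq> j \<and> t \<in> carrier \<Gamma> \<and> (g = b i k \<otimes> t \<and> h = b j k \<otimes> t)"
      unfolding w parcs_rgraph using assms by blast
    also have "\<dots> \<longleftrightarrow> k < n \<and> k \<noteq> i \<and> k \<noteq> j \<and> t \<in> carrier \<Gamma> \<and>
        (t = b k j \<otimes> h \<and> b i k \<otimes> b k j = g \<otimes> inv h)"
      using * by blast
    also have "\<dots> \<longleftrightarrow> k \<in> middle i j (g \<otimes> inv h) \<and> t = b k j \<otimes> h"
      unfolding middle_def using assms b_closed by auto
    finally show ?thesis unfolding w by auto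
  qed
  then have "{w. ((i, g), w) \<in> parcs rgraph \<and> ((j, h), w) \<in> parcs rgraph} =
      (\<lambda>k. (k, b k j \<otimes> h)) ` middle i j (g \<otimes> inv h)" by blast
  then show ?thesis by (simp only: card_image[OF inj])
qed

lemma b_times_inv_iff:
  assumes "i < n" "j < n" "i \<noteq> j" "g \<in> carrier \<Gamma>" "h \<in> carrier \<Gamma>"
  shows "g \<otimes> inv h = b i j \<longleftrightarrow> g = b i j \<otimes> h"
  using assms b_closed inv_solve_right[of "b i j" g h] by auto

text \<open>Distance-regularity for the distances 1 and 1 makes the number of common neighbours a
  function of the distance. It remains to see that nonadjacent vertices in distinct fibres all have
  the same distance, while the diameter is still unknown.\<close>

lemma drackn_counts:
  assumes dr: "drackn rgraph (roux_fibres \<Gamma> n)"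
  obtains a c where "\<And>i j x. \<lbrakk>i < n; j < n; i \<noteq> j; x \<in> carrier \<Gamma>\<rbrakk> \<Longrightarrow>
    card (middle i j x) = (if x = b i j then a else c)"
proof -
  let ?d = "graph_dist rgraph"
  let ?D = "graph_diameter rgraph"
  define cn where "cn u v = card {w. (u, w) \<in> parcs rgraph \<and> (v, w) \<in> parcs rgraph}" for u v
  have cn_dist: "cn u v = card {w \<in> pverts rgraph. ?d u w = 1 \<and> ?d v w = 1}" for u v
    unfolding cn_def rg.graph_dist_eq_1_iff using rg.in_arcsD2 by (intro arg_cong[of _ _ card]) blast
  have same: "cn u v = cn u' v'" if "u \<in> pverts rgraph" "v \<in> pverts rgraph"
      "u' \<in> pverts rgraph" "v' \<in> pverts rgraph" "?d u v = ?d u' v'" for u v u' v'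
    using dr that unfolding drackn_def distance_regular_def cn_dist by blast
  have fibre: "?d (i, g) (j, h) = ?D \<longleftrightarrow> i = j"
    if "i < n" "j < n" "g \<in> carrier \<Gamma>" "h \<in> carrier \<Gamma>" "(i, g) \<noteq> (j, h)" for i j g h
  proof -
    have "?d (i, g) (j, h) = ?D \<longleftrightarrow> (\<exists>F\<in>roux_fibres \<Gamma> n. (i, g) \<in> F \<and> (j, h) \<in> F)"
      using dr that unfolding drackn_def pverts_rgraph by blast
    also have "\<dots> \<longleftrightarrow> i = j" using that by (auto simp: roux_fibres_def)
    finally show ?thesis .
  qed
  have le_D: "?d u v \<le> ?D" if "u \<in> pverts rgraph" "v \<in> pverts rgraph" for u v
    unfolding graph_diameter_def using that by (intro SUP_upper2[of "(u, v)"]) auto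
  \<comment> \<open>A vertex outside the fibre of \<open>(j, h)\<close> and not adjacent to it has a neighbour in that fibre,
    which is at distance the diameter; so it is itself one step closer.\<close>
  have nonadj: "eSuc (?d (i, g) (j, h)) = ?D"
    if ij: "i < n" "j < n" "i \<noteq> j" and gh: "g \<in> carrier \<Gamma>" "h \<in> carrier \<Gamma>"
      and na: "g \<noteq> b i j \<otimes> h" for i j g h
  proof -
    let ?w = "(j, b j i \<otimes> g)"
    have w: "b j i \<otimes> g \<in> carrier \<Gamma>" using ij gh b_closed by auto
    have "(?w, (i, g)) \<in> parcs rgraph" using ij gh w by (simp add: parcs_rgraph)
    then have "?d ?w (j, h) \<le> eSuc (?d (i, g) (j, h))" by (rule rg.graph_dist_arc_le)
    moreover have "?d ?w (j, h) = ?D"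
      using fibre[of j j "b j i \<otimes> g" h] ij gh w na b_swap[of i j g h] by auto
    moreover have "?d (i, g) (j, h) \<noteq> ?D" using fibre[of i j g h] ij gh by auto
    moreover have "?d (i, g) (j, h) \<le> ?D" using le_D ij gh by (simp add: pverts_rgraph)
    ultimately show ?thesis by (metis ileI1 order_antisym order_le_neq_trans)
  qed
  \<comment> \<open>Both constants are read off from fibres 0 and 1. If the group has no element
    besides \<open>b 0 1\<close>, the choice inside \<open>c\<close> is arbitrary, but then the case
    x \<noteq> b i j does not arise.\<close>
  define a where "a = cn (0, b 0 1) (1, \<one>)"
  define c where "c = (let x = (SOME x. x \<in> carrier \<Gamma> \<and> x \<noteq> b 0 1) in cn (0, x) (1, \<one>))"
  show thesis
  proof (rule that)
    fix i j x assume ij: "i < n" "j < n" "i \<noteq> j" and x: "x \<in> carrier \<Gamma>"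
    have n: "0 < n" "1 < n" using ij by auto
    have b01: "b 0 1 \<in> carrier \<Gamma>" using n b_closed by simp
    have m: "card (middle i j x) = cn (i, x) (j, \<one>)"
      unfolding cn_def using common_neighbours[of i j x \<one>] ij x by simp
    show "card (middle i j x) = (if x = b i j then a else c)"
    proof (cases "x = b i j")
      case True
      have "?d (i, x) (j, \<one>) = 1" "?d (0, b 0 1) (1, \<one>) = 1"
        using ij x True n b01 by (auto simp: rg.graph_dist_eq_1_iff parcs_rgraph)
      then have "cn (i, x) (j, \<one>) = a"
        unfolding a_def using ij x n b01 by (intro same) (auto simp: pverts_rgraph)
      then show ?thesis using True m by simp
    next
      case False
      have "\<exists>y. y \<in> carrier \<Gamma> \<and> y \<noteq> b 0 1"
      proof (rule ccontr)
        assume "\<nexists>y. y \<in> carrier \<Gamma> \<and> y \<noteq> b 0 1"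
        then show False using False x b_closed[OF ij] by metis
      qed
      then have y: "(SOME x. x \<in> carrier \<Gamma> \<and> x \<noteq> b 0 1) \<in> carrier \<Gamma>"
        "(SOME x. x \<in> carrier \<Gamma> \<and> x \<noteq> b 0 1) \<noteq> b 0 1"
        using someI_ex[of "\<lambda>y. y \<in> carrier \<Gamma> \<and> y \<noteq> b 0 1"] by blast+
      have "eSuc (?d (i, x) (j, \<one>)) = ?D" using nonadj[of i j x \<one>] ij x False b_closed by simp
      moreover have "eSuc (?d (0, SOME x. x \<in> carrier \<Gamma> \<and> x \<noteq> b 0 1) (1, \<one>)) = ?D"
        using nonadj[of 0 1 _ \<one>] n y b01 by simp
      ultimately have "?d (i, x) (j, \<one>) = ?d (0, SOME x. x \<in> carrier \<Gamma> \<and> x \<noteq> b 0 1) (1, \<one>)"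
        by (metis eSuc_inject)
      then have "cn (i, x) (j, \<one>) = c"
        unfolding c_def Let_def using ij x n y by (intro same) (simp_all add: pverts_rgraph)
      then show ?thesis using False m by simp
    qed
  qed
qed

end

section \<open>Characters and the spectra of DRACKN lines\<close>

lemma group_characterD:
  assumes "group_character \<Gamma> \<alpha>" "x \<in> carrier \<Gamma>"
  shows "cmod (\<alpha> x) = 1" "\<alpha> x \<noteq> 0" "y \<in> carrier \<Gamma> \<Longrightarrow> \<alpha> (x \<otimes>\<^bsub>\<Gamma>\<^esub> y) = \<alpha> x * \<alpha> y"
proof -
  show "cmod (\<alpha> x) = 1" using assms unfolding group_character_def by blast
  then show "\<alpha> x \<noteq> 0" by force
  show "y \<in> carrier \<Gamma> \<Longrightarrow> \<alpha> (x \<otimes>\<^bsub>\<Gamma>\<^esub> y) = \<alpha> x * \<alpha> y"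
    using assms unfolding group_character_def by blast
qed

lemma group_character_power:
  "group_character \<Gamma> \<alpha> \<Longrightarrow> group_character \<Gamma> (\<lambda>x. \<alpha> x ^ k)"
  unfolding group_character_def by (simp add: norm_power power_mult_distrib)

lemma (in group) group_character_one:
  assumes "group_character G \<alpha>" shows "\<alpha> \<one> = 1"
  using group_characterD(2)[OF assms one_closed] group_characterD(3)[OF assms one_closed one_closed] by simp

text \<open>The group order is an exponent that trivializes every character value; this guarantees
  that a least exponent r exists.\<close>

lemma (in group) group_character_order:
  assumes \<alpha>: "group_character G \<alpha>" and x: "x \<in> carrier G"
  shows "\<alpha> x ^ Coset.order G = 1"
proof -
  have "\<alpha> (x [^] k) = \<alpha> x ^ k" for k :: nat
    by (induction k) (simp_all add: group_character_one[OF \<alpha>] group_characterD(3)[OF \<alpha>] x)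
  then show ?thesis using pow_order_eq_1[OF x] group_character_one[OF \<alpha>] by metis
qed

text \<open>Translation by \<open>y\<close> permutes the summands and multiplies the sum by \<alpha>
  y \<noteq> 1.\<close>

lemma (in group) sum_nontrivial_character:
  assumes \<alpha>: "group_character G \<alpha>" and y: "y \<in> carrier G" "\<alpha> y \<noteq> 1"
  shows "(\<Sum>x\<in>carrier G. \<alpha> x) = 0"
proof -
  have bij: "bij_betw (\<lambda>x. y \<otimes> x) (carrier G) (carrier G)"
    by (rule bij_betwI[where g = "\<lambda>x. inv y \<otimes> x"]) (use y in \<open>auto simp flip: m_assoc\<close>)
  have "(\<Sum>x\<in>carrier G. \<alpha> x) = (\<Sum>x\<in>carrier G. \<alpha> (y \<otimes> x))"
    by (rule sum.reindex_bij_betw[OF bij, symmetric])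
  also have "\<dots> = \<alpha> y * (\<Sum>x\<in>carrier G. \<alpha> x)"
    using group_characterD(3)[OF \<alpha> y(1)] by (simp add: sum_distrib_left)
  finally show ?thesis using y(2) by simp
qed

section \<open>Squares of evaluated roux matrices\<close>

context roux_array
begin

text \<open>Evaluation at a character is multiplicative, so squaring the evaluated matrix amounts to
  evaluating the square of \<open>rmat\<close>, whose coefficients are the counts. The indices l = i
  and l = j drop out because the diagonal is 0.\<close>

lemma sum_middle:
  assumes \<beta>: "group_character \<Gamma> \<beta>" and ij: "i < n" "j < n"
  shows "(\<Sum>l<n. eval_at_character \<Gamma> \<beta> rmat $$ (i, l) * eval_at_character \<Gamma> \<beta> rmat $$ (l, j)) =
    (\<Sum>x\<in>carrier \<Gamma>. of_nat (card (middle i j x)) * \<beta> x)"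
proof -
  define L where "L = {..<n} - {i, j}"
  have b: "b i l \<in> carrier \<Gamma>" "b l j \<in> carrier \<Gamma>" if "l \<in> L" for l
    using that ij b_closed unfolding L_def by auto
  have "(\<Sum>l<n. eval_at_character \<Gamma> \<beta> rmat $$ (i, l) * eval_at_character \<Gamma> \<beta> rmat $$ (l, j)) =
      (\<Sum>l\<in>L. eval_at_character \<Gamma> \<beta> rmat $$ (i, l) * eval_at_character \<Gamma> \<beta> rmat $$ (l, j))"
    unfolding L_def using ij by (intro sum.mono_neutral_right) (auto simp: eval_rmat_index)
  also have "\<dots> = (\<Sum>l\<in>L. \<beta> (b i l \<otimes> b l j))"
    using ij b by (intro sum.cong refl) (auto simp: L_def eval_rmat_index group_characterD(3)[OF \<beta>])
  also have "\<dots> = (\<Sum>x\<in>carrier \<Gamma>. \<Sum>l\<in>{l \<in> L. b i l \<otimes> b l j = x}. \<beta> (b i l \<otimes> b l j))"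
    using b by (intro sum.group[symmetric]) (auto simp: L_def finite_carrier)
  also have "\<dots> = (\<Sum>x\<in>carrier \<Gamma>. of_nat (card (middle i j x)) * \<beta> x)"
  proof (intro sum.cong refl)
    fix x
    have "middle i j x = {l \<in> L. b i l \<otimes> b l j = x}" unfolding middle_def L_def by auto
    then show "(\<Sum>l\<in>{l \<in> L. b i l \<otimes> b l j = x}. \<beta> (b i l \<otimes> b l j)) =
        of_nat (card (middle i j x)) * \<beta> x" by simp
  qed
  finally show ?thesis .
qed

lemma middle_diagonal:
  assumes "i < n"
  shows "middle i i x = (if x = \<one> then {..<n} - {i} else {})"
proof -
  have "b i k \<otimes> b k i = \<one>" if "k < n" "k \<noteq> i" for k
    using assms that b_closed[of i k] b_inverse[of i k] by simp
  then show ?thesis unfolding middle_def by auto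
qed

text \<open>Off the diagonal, the common value c is summed against a nontrivial character and
  disappears; only the excess a - c at \<open>b i j\<close> survives. On the diagonal every product
  b i k \<otimes> b k i is \<one>.\<close>

lemma eval_rmat_square:
  assumes counts: "\<And>i j x. \<lbrakk>i < n; j < n; i \<noteq> j; x \<in> carrier \<Gamma>\<rbrakk> \<Longrightarrow>
      card (middle i j x) = (if x = b i j then a else c)"
    and \<beta>: "group_character \<Gamma> \<beta>" and y: "y \<in> carrier \<Gamma>" "\<beta> y \<noteq> 1" and ij: "i < n" "j < n"
  shows "(\<Sum>l<n. eval_at_character \<Gamma> \<beta> rmat $$ (i, l) * eval_at_character \<Gamma> \<beta> rmat $$ (l, j)) =
    (of_nat a - of_nat c) * eval_at_character \<Gamma> \<beta> rmat $$ (i, j) + (if i = j then of_nat (n - 1) else 0)"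
proof (cases "i = j")
  case True
  have "(\<Sum>x\<in>carrier \<Gamma>. of_nat (card (middle i j x)) * \<beta> x) =
      (\<Sum>x\<in>carrier \<Gamma>. if x = \<one> then of_nat (n - 1) else 0)"
    using ij True by (intro sum.cong) (auto simp: middle_diagonal group_character_one[OF \<beta>])
  then show ?thesis
    unfolding sum_middle[OF \<beta> ij] using True ij finite_carrier by (simp add: eval_rmat_index)
next
  case False
  have "(\<Sum>x\<in>carrier \<Gamma>. of_nat (card (middle i j x)) * \<beta> x) =
      (\<Sum>x\<in>carrier \<Gamma>. of_nat c * \<beta> x + (if x = b i j then (of_nat a - of_nat c) * \<beta> (b i j) else 0))"
    using ij False by (intro sum.cong) (auto simp: counts algebra_simps)
  also have "\<dots> = of_nat c * (\<Sum>x\<in>carrier \<Gamma>. \<beta> x) + (of_nat a - of_nat c) * \<beta> (b i j)"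
    using finite_carrier b_closed[OF ij False] by (simp add: sum.distrib sum_distrib_left)
  also have "\<dots> = (of_nat a - of_nat c) * \<beta> (b i j)"
    using sum_nontrivial_character[OF \<beta> y] by simp
  finally show ?thesis
    unfolding sum_middle[OF \<beta> ij] using False ij by (simp add: eval_rmat_index)
qed

end

lemma vieta_exists:
  fixes s p :: complex
  obtains \<theta> \<tau> where "\<theta> + \<tau> = s" "\<theta> * \<tau> = p"
proof -
  define q where "q = csqrt (s\<^sup>2 - 4 * p)"
  have "q * q = s\<^sup>2 - 4 * p" unfolding q_def by (metis power2_csqrt power2_eq_square)
  then have "(s + q) / 2 * ((s - q) / 2) = p"
    by (simp add: field_simps power2_eq_square)
  then show thesis using that[of "(s + q) / 2" "(s - q) / 2"] by (simp add: field_simps)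
qed

text \<open>Another choice of unit representatives multiplies the Gram matrix by a unimodular diagonal
  matrix on both sides; comparing moduli of entries shows that \<open>\<mu>\<close> does not change.\<close>

lemma signature_matrix_switching:
  assumes n: "n \<ge> 2" and S: "lines_have_signature_matrix d n L S"
    and T: "lines_have_signature_matrix d n L T"
  obtains e where "\<And>i. i < n \<Longrightarrow> cmod (e i) = 1"
    "\<And>i j. \<lbrakk>i < n; j < n\<rbrakk> \<Longrightarrow> S $$ (i, j) = e j * cnj (e i) * T $$ (i, j)"
proof -
  obtain \<phi> \<mu> where \<phi>: "unit_norm_representatives d n L \<phi>" and sS: "signature_matrix n S"
    and \<mu>: "(\<mu>::real) > 0" and gS: "gram_matrix n \<phi> = 1\<^sub>m n + complex_of_real \<mu> \<cdot>\<^sub>m S"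
    using S unfolding lines_have_signature_matrix_def vectors_have_signature_matrix_def by blast
  obtain \<psi> \<nu> where \<psi>: "unit_norm_representatives d n L \<psi>" and sT: "signature_matrix n T"
    and \<nu>: "(\<nu>::real) > 0" and gT: "gram_matrix n \<psi> = 1\<^sub>m n + complex_of_real \<nu> \<cdot>\<^sub>m T"
    using T unfolding lines_have_signature_matrix_def vectors_have_signature_matrix_def by blast
  have "\<exists>c. \<phi> i = c \<cdot>\<^sub>v \<psi> i" if "i < n" for i
  proof -
    have "1 \<cdot>\<^sub>v \<phi> i \<in> line_through (\<phi> i)" unfolding line_through_def by blast
    then have "\<phi> i \<in> line_through (\<psi> i)"
      using \<phi> \<psi> that unfolding unit_norm_representatives_def by simp
    then show ?thesis unfolding line_through_def by blast
  qed
  then obtain e where e: "\<And>i. i < n \<Longrightarrow> \<phi> i = e i \<cdot>\<^sub>v \<psi> i" by metis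
  have car: "\<psi> i \<in> carrier_vec d" if "i < n" for i
    using \<psi> that unfolding unit_norm_representatives_def by blast
  have ip: "\<phi> j \<bullet>c \<phi> i = e j * cnj (e i) * (\<psi> j \<bullet>c \<psi> i)" if "i < n" "j < n" for i j
    using car[OF that(1)] car[OF that(2)]
    by (simp add: e[OF that(1)] e[OF that(2)] conjugate_smult_vec)
  have unit: "cmod (e i) = 1" if "i < n" for i
  proof -
    have "\<phi> i \<bullet>c \<phi> i = 1" "\<psi> i \<bullet>c \<psi> i = 1"
      using \<phi> \<psi> that unfolding unit_norm_representatives_def by auto
    then have "e i * cnj (e i) = 1" using ip[OF that that] by simp
    then have "(cmod (e i))\<^sup>2 = 1" by (metis complex_norm_square of_real_eq_1_iff)
    then show ?thesis by (metis norm_ge_zero power2_eq_1_iff zero_neq_one neg_0_le_iff_le not_one_le_zero)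
  qed
  have S0: "S \<in> carrier_mat n n" "\<And>i. i < n \<Longrightarrow> S $$ (i, i) = 0"
      "\<And>i j. \<lbrakk>i < n; j < n; i \<noteq> j\<rbrakk> \<Longrightarrow> cmod (S $$ (i, j)) = 1"
    using sS unfolding signature_matrix_def by auto
  have T0: "T \<in> carrier_mat n n" "\<And>i. i < n \<Longrightarrow> T $$ (i, i) = 0"
      "\<And>i j. \<lbrakk>i < n; j < n; i \<noteq> j\<rbrakk> \<Longrightarrow> cmod (T $$ (i, j)) = 1"
    using sT unfolding signature_matrix_def by auto
  have off: "\<mu> * S $$ (i, j) = e j * cnj (e i) * (\<nu> * T $$ (i, j))"
    if "i < n" "j < n" "i \<noteq> j" for i j
  proof -
    have "\<phi> j \<bullet>c \<phi> i = (1\<^sub>m n + complex_of_real \<mu> \<cdot>\<^sub>m S) $$ (i, j)"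
      using that by (simp add: gS[symmetric] gram_matrix_def)
    moreover have "\<psi> j \<bullet>c \<psi> i = (1\<^sub>m n + complex_of_real \<nu> \<cdot>\<^sub>m T) $$ (i, j)"
      using that by (simp add: gT[symmetric] gram_matrix_def)
    ultimately show ?thesis using ip[OF that(1,2)] that S0(1) T0(1) by simp
  qed
  have "\<mu> = \<nu>"
  proof -
    have "cmod (\<mu> * S $$ (0, 1)) = cmod (e 1 * cnj (e 0) * (\<nu> * T $$ (0, 1)))"
      using off[of 0 1] n by simp
    then show ?thesis
      using n \<mu> \<nu> S0(3)[of 0 1] T0(3)[of 0 1] unit[of 0] unit[of 1] by (simp add: norm_mult)
  qed
  then have "S $$ (i, j) = e j * cnj (e i) * T $$ (i, j)" if "i < n" "j < n" for i j
    using off[OF that] S0(2) T0(2) that \<mu> by (cases "i = j") auto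
  then show thesis using that unit by blast
qed

text \<open>The Hadamard powers of \<open>S\<close> are evaluations at \<alpha>^k up to switching,
  which does not affect a quadratic matrix equation. The only danger is a trivial \<alpha>^k, and
  the least exponent r rules it out for 0 < k < r.\<close>

lemma (in roux_array) drackn_imp_spectra:
  assumes n: "n \<ge> 2" and dr: "drackn rgraph (roux_fibres \<Gamma> n)" and \<alpha>: "group_character \<Gamma> \<alpha>"
    and S: "S \<in> carrier_mat n n"
    and e: "\<And>i. i < n \<Longrightarrow> cmod (e i) = 1"
    and sw: "\<And>i j. \<lbrakk>i < n; j < n\<rbrakk> \<Longrightarrow>
      S $$ (i, j) = e j * cnj (e i) * eval_at_character \<Gamma> \<alpha> rmat $$ (i, j)"
    and normal: "\<And>i. \<lbrakk>i < n; i \<noteq> 0\<rbrakk> \<Longrightarrow> S $$ (0, i) = 1"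
  shows "\<exists>r::nat.
       (r > 0 \<and> (\<forall>i<n. \<forall>j<n. i \<noteq> j \<longrightarrow> (S $$ (i, j)) ^ r = 1) \<and>
        (\<forall>m. 0 < m \<and> m < r \<longrightarrow> \<not> (\<forall>i<n. \<forall>j<n. i \<noteq> j \<longrightarrow> (S $$ (i, j)) ^ m = 1))) \<and>
       (\<exists>\<theta> \<tau> :: complex. \<forall>k \<in> {1..r - 1}. spectrum (hadamard_power S k) = {\<theta>, \<tau>})"
proof -
  have ee: "e i * cnj (e i) = 1" if "i < n" for i
    using e[OF that] by (metis complex_norm_square of_real_1 one_power2)
  have sw_power: "(S $$ (i, j)) ^ k = e j ^ k * cnj (e i) ^ k * \<alpha> (b i j) ^ k"
    if "i < n" "j < n" "i \<noteq> j" for i j k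
    using sw[OF that(1,2)] that by (simp add: eval_rmat_index power_mult_distrib)
  \<comment> \<open>If \<alpha>^k is trivial, the k-th powers of the entries of \<open>S\<close>
    consist of switching factors alone, and the first row of ones forces all e i ^ k to coincide.
    Contrapositively, an entry whose k-th power is not 1 yields some y with \<alpha> y ^ k \<noteq>
    1.\<close>
  have triv: "(S $$ (i, j)) ^ k = 1"
    if k: "\<And>x. x \<in> carrier \<Gamma> \<Longrightarrow> \<alpha> x ^ k = 1" and ij: "i < n" "j < n" "i \<noteq> j" for i j k
  proof -
    have pw: "(S $$ (i, j)) ^ k = e j ^ k * cnj (e i) ^ k" if "i < n" "j < n" "i \<noteq> j" for i j
      using sw_power[OF that, of k] k b_closed that by simp
    have e0: "e i ^ k = e 0 ^ k" if i: "i < n" for i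
    proof (cases "i = 0")
      case False
      have "e i ^ k * cnj (e 0) ^ k = 1" using pw[of 0 i] normal[of i] i False by simp
      then have "e i ^ k * (e 0 * cnj (e 0)) ^ k = e 0 ^ k" by (simp add: power_mult_distrib mult_ac)
      then show ?thesis using ee[of 0] n by simp
    qed simp
    have "(S $$ (i, j)) ^ k = e i ^ k * cnj (e i) ^ k" using pw[OF ij] e0 ij by metis
    also have "\<dots> = 1" using ee[OF ij(1)] by (simp flip: power_mult_distrib)
    finally show ?thesis .
  qed
  define P where "P m \<longleftrightarrow> 0 < m \<and> (\<forall>i<n. \<forall>j<n. i \<noteq> j \<longrightarrow> (S $$ (i, j)) ^ m = 1)" for m
  have "Coset.order \<Gamma> > 0"
    using finite_carrier one_closed by (auto simp: Coset.order_def card_gt_0_iff)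
  then have "P (Coset.order \<Gamma>)" unfolding P_def using triv group_character_order[OF \<alpha>] by blast
  then have P: "P (LEAST m. P m)" by (rule LeastI)
  define r where "r = (LEAST m. P m)"
  have min: "\<not> P m" if "m < r" for m using that not_less_Least unfolding r_def by blast
  obtain a c where counts: "\<And>i j x. \<lbrakk>i < n; j < n; i \<noteq> j; x \<in> carrier \<Gamma>\<rbrakk> \<Longrightarrow>
      card (middle i j x) = (if x = b i j then a else c)"
    using drackn_counts[OF dr] by blast
  \<comment> \<open>Chosen before k: the coefficients depend only on n and the counts, so one pair
    of roots serves all k.\<close>
  obtain \<theta> \<tau> :: complex where \<theta>\<tau>: "\<theta> + \<tau> = of_nat a - of_nat c" "\<theta> * \<tau> = - of_nat (n - 1)"
    using vieta_exists by metis
  have "spectrum (hadamard_power S k) = {\<theta>, \<tau>}" if k: "k \<in> {1..r - 1}" for k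
  proof -
    have "\<not> P k" using k by (intro min) auto
    then obtain i j where "i < n" "j < n" "i \<noteq> j" "(S $$ (i, j)) ^ k \<noteq> 1"
      using k unfolding P_def by auto
    then obtain y where y: "y \<in> carrier \<Gamma>" "\<alpha> y ^ k \<noteq> 1" using triv by blast
    define \<beta> where "\<beta> x = \<alpha> x ^ k" for x
    have \<beta>: "group_character \<Gamma> \<beta>" unfolding \<beta>_def by (rule group_character_power[OF \<alpha>])
    have \<beta>y: "\<beta> y \<noteq> 1" using y(2) unfolding \<beta>_def .
    let ?H = "hadamard_power S k" and ?T = "eval_at_character \<Gamma> \<beta> rmat"
    \<comment> \<open>Here k > 0 matters: it keeps the diagonal entries 0 ^ k equal to 0.\<close>
    have H: "?H $$ (i, j) = e j ^ k * cnj (e i) ^ k * ?T $$ (i, j)" if "i < n" "j < n" for i j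
      using that k sw_power[OF that, of k] sw[OF that] S
      by (cases "i = j") (auto simp: hadamard_power_def eval_rmat_index \<beta>_def)
    have eek: "e i ^ k * cnj (e i) ^ k = 1" if "i < n" for i
      using ee[OF that] by (simp flip: power_mult_distrib)
    show ?thesis
    proof (rule spectrum_of_quadratic)
      show "?H \<in> carrier_mat n n" using S by (simp add: hadamard_power_def)
      show "0 < n" "1 < n" "0 \<noteq> (1::nat)" using n by auto
      show "?H $$ (0, 1) \<noteq> 0" using normal[of 1] S n by (simp add: hadamard_power_def)
      fix i j assume ij: "i < n" "j < n"
      have sq: "(\<Sum>l<n. ?T $$ (i, l) * ?T $$ (l, j)) =
          (of_nat a - of_nat c) * ?T $$ (i, j) + (if i = j then of_nat (n - 1) else 0)"
        by (rule eval_rmat_square[OF _ \<beta> y(1) \<beta>y ij]) (rule counts)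
      have "(\<Sum>l<n. ?H $$ (i, l) * ?H $$ (l, j)) =
          (\<Sum>l<n. e j ^ k * cnj (e i) ^ k * (?T $$ (i, l) * ?T $$ (l, j)))"
      proof (intro sum.cong refl)
        fix l assume "l \<in> {..<n}"
        then have l: "l < n" by simp
        \<comment> \<open>The switching factors of the inner index l cancel, as in conjugation by a
          unitary diagonal matrix.\<close>
        have "?H $$ (i, l) * ?H $$ (l, j) =
            (e l ^ k * cnj (e l) ^ k) * (e j ^ k * cnj (e i) ^ k * (?T $$ (i, l) * ?T $$ (l, j)))"
          by (simp only: H ij l mult_ac)
        then show "?H $$ (i, l) * ?H $$ (l, j) =
            e j ^ k * cnj (e i) ^ k * (?T $$ (i, l) * ?T $$ (l, j))"
          by (simp only: eek l mult_1_left)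
      qed
      also have "\<dots> = e j ^ k * cnj (e i) ^ k *
          ((of_nat a - of_nat c) * ?T $$ (i, j) + (if i = j then of_nat (n - 1) else 0))"
        unfolding sum_distrib_left[symmetric] sq ..
      also have "\<dots> = (\<theta> + \<tau>) * ?H $$ (i, j) - (if i = j then \<theta> * \<tau> else 0)"
        unfolding \<theta>\<tau> H[OF ij] using eek[OF ij(1)] by (cases "i = j") simp_all
      finally show "(\<Sum>l<n. ?H $$ (i, l) * ?H $$ (l, j)) =
          (\<theta> + \<tau>) * ?H $$ (i, j) - (if i = j then \<theta> * \<tau> else 0)" .
    qed
  qed
  then have "\<exists>\<theta> \<tau>. \<forall>k\<in>{1..r - 1}. spectrum (hadamard_power S k) = {\<theta>, \<tau>}" by blast
  moreover have "r > 0 \<and> (\<forall>i<n. \<forall>j<n. i \<noteq> j \<longrightarrow> (S $$ (i, j)) ^ r = 1)"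
    using P unfolding r_def[symmetric] unfolding P_def .
  moreover have "\<forall>m. 0 < m \<and> m < r \<longrightarrow> \<not> (\<forall>i<n. \<forall>j<n. i \<noteq> j \<longrightarrow> (S $$ (i, j)) ^ m = 1)"
    using min unfolding P_def by blast
  ultimately show ?thesis by blast
qed

text \<open>The data from which a regular abelian DRACKN is built. With
  \<open>b 0 j = \<one>\<close> the cover is already normalized; c > 0 gives nonadjacent vertices of
  distinct fibres a common neighbour and makes the entries generate the group; a nontrivial element
  puts two vertices into a fibre, so that distance 3 occurs.\<close>

locale roux_drackn = roux_array \<Gamma> n b
  for \<Gamma> :: "('g, 'm) monoid_scheme" (structure) and n :: nat and b :: "nat \<Rightarrow> nat \<Rightarrow> 'g" +
  fixes a c :: nat
  assumes n_ge_2: "n \<ge> 2"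
    and normalized: "\<lbrakk>0 < j; j < n\<rbrakk> \<Longrightarrow> b 0 j = \<one>"
    and counts: "\<lbrakk>i < n; j < n; i \<noteq> j; x \<in> carrier \<Gamma>\<rbrakk> \<Longrightarrow>
      card (middle i j x) = (if x = b i j then a else c)"
    and c_pos: "c > 0"
    and nontrivial: "\<exists>g\<in>carrier \<Gamma>. g \<noteq> \<one>"

section \<open>The roux algebra\<close>

text \<open>\<open>gr_span\<close> sums over a set of matrices; an indexed family may repeat a
  matrix, as happens when products of different generators coincide.\<close>

definition gr_lincomb :: "nat \<Rightarrow> 't set \<Rightarrow> ('t \<Rightarrow> complex) \<Rightarrow> ('t \<Rightarrow> ('g \<Rightarrow> complex) mat) \<Rightarrow>
    ('g \<Rightarrow> complex) mat" where
  "gr_lincomb n I c M = mat n n (\<lambda>(i, j). \<lambda>x. \<Sum>t\<in>I. c t * (M t $$ (i, j)) x)"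

lemma gr_span_eq: "gr_span n \<A> = {gr_lincomb n F c (\<lambda>M. M) | F c. finite F \<and> F \<subseteq> \<A>}"
  by (simp add: gr_span_def gr_lincomb_def)

lemma gr_lincomb_generators:
  assumes "finite I" "\<And>t. t \<in> I \<Longrightarrow> M t \<in> \<A>"
  shows "gr_lincomb n I c M \<in> gr_span n \<A>"
proof -
  \<comment> \<open>Coefficients of equal matrices are added up, since \<open>gr_span\<close> has a
    single coefficient per matrix.\<close>
  define e where "e N = (\<Sum>t\<in>{t \<in> I. M t = N}. c t)" for N
  have "(\<Sum>t\<in>I. c t * (M t $$ (i, j)) x) = (\<Sum>N\<in>M ` I. e N * (N $$ (i, j)) x)" for i j x
  proof -
    have "(\<Sum>t\<in>I. c t * (M t $$ (i, j)) x) =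
        (\<Sum>N\<in>M ` I. \<Sum>t\<in>{t \<in> I. M t = N}. c t * (M t $$ (i, j)) x)"
      using assms(1) by (intro sum.group[symmetric]) auto
    also have "\<dots> = (\<Sum>N\<in>M ` I. e N * (N $$ (i, j)) x)"
      unfolding e_def sum_distrib_right by (intro sum.cong) auto
    finally show ?thesis .
  qed
  then have "gr_lincomb n I c M = gr_lincomb n (M ` I) e (\<lambda>N. N)"
    unfolding gr_lincomb_def by simp
  then show ?thesis unfolding gr_span_eq using assms by blast
qed

text \<open>A combination of combinations is flattened over the pairs (t, N), which keep apart the
  contributions of different t to the same generator.\<close>

lemma gr_lincomb_span:
  assumes "finite I" "\<And>t. t \<in> I \<Longrightarrow> M t \<in> gr_span n \<A>"
  shows "gr_lincomb n I c M \<in> gr_span n \<A>"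
proof -
  have "\<forall>t\<in>I. \<exists>F e. finite F \<and> F \<subseteq> \<A> \<and> M t = gr_lincomb n F e (\<lambda>N. N)"
    using assms(2) unfolding gr_span_eq by blast
  then obtain F e where F: "\<And>t. t \<in> I \<Longrightarrow> finite (F t) \<and> F t \<subseteq> \<A> \<and> M t = gr_lincomb n (F t) (e t) (\<lambda>N. N)"
    by metis
  have "gr_lincomb n I c M = gr_lincomb n (Sigma I F) (\<lambda>(t, N). c t * e t N) snd"
  proof (rule eq_matI)
    fix i j assume "i < dim_row (gr_lincomb n (Sigma I F) (\<lambda>(t, N). c t * e t N) snd)"
      "j < dim_col (gr_lincomb n (Sigma I F) (\<lambda>(t, N). c t * e t N) snd)"
    then have ij: "i < n" "j < n" by (auto simp: gr_lincomb_def)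
    have "(\<Sum>t\<in>I. c t * (M t $$ (i, j)) x) =
        (\<Sum>p\<in>Sigma I F. (case p of (t, N) \<Rightarrow> c t * e t N) * (snd p $$ (i, j)) x)" for x
    proof -
      have "(\<Sum>t\<in>I. c t * (M t $$ (i, j)) x) = (\<Sum>t\<in>I. \<Sum>N\<in>F t. c t * e t N * (N $$ (i, j)) x)"
        using F ij by (intro sum.cong refl) (simp add: gr_lincomb_def sum_distrib_left mult.assoc)
      also have "\<dots> = (\<Sum>p\<in>Sigma I F. (case p of (t, N) \<Rightarrow> c t * e t N) * (snd p $$ (i, j)) x)"
        using assms(1) F by (subst sum.Sigma) (auto intro!: sum.cong)
      finally show ?thesis .
    qed
    then show "gr_lincomb n I c M $$ (i, j) =
        gr_lincomb n (Sigma I F) (\<lambda>(t, N). c t * e t N) snd $$ (i, j)"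
      using ij by (simp add: gr_lincomb_def)
  qed (auto simp: gr_lincomb_def)
  also have "\<dots> \<in> gr_span n \<A>"
  proof (rule gr_lincomb_generators)
    show "finite (Sigma I F)" using assms(1) F by blast
    show "snd p \<in> \<A>" if "p \<in> Sigma I F" for p using that F by fastforce
  qed
  finally show ?thesis .
qed

lemma gr_span_generator:
  assumes "M \<in> \<A>" "M \<in> carrier_mat n n"
  shows "M \<in> gr_span n \<A>"
proof -
  have "M = gr_lincomb n {()} (\<lambda>_. 1) (\<lambda>_. M)"
    using assms(2) by (intro eq_matI) (auto simp: gr_lincomb_def)
  moreover have "gr_lincomb n {()} (\<lambda>_. 1) (\<lambda>_. M) \<in> gr_span n \<A>"
    using assms(1) by (intro gr_lincomb_generators) auto
  ultimately show ?thesis by simp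
qed

lemma gr_mult_zero: "gr_mult \<Gamma> f (\<lambda>_. 0) = (\<lambda>_. 0)" "gr_mult \<Gamma> (\<lambda>_. 0) f = (\<lambda>_. 0)"
  by (auto simp: gr_mult_def)

lemma gr_mult_sum:
  assumes "finite I" "finite J"
  shows "gr_mult \<Gamma> (\<lambda>x. \<Sum>t\<in>I. c t * f t x) (\<lambda>x. \<Sum>s\<in>J. e s * h s x) x =
    (\<Sum>(t, s)\<in>I \<times> J. c t * e s * gr_mult \<Gamma> (f t) (h s) x)"
proof (cases "x \<in> carrier \<Gamma>")
  case True
  have "(\<Sum>t\<in>I. c t * f t y) * (\<Sum>s\<in>J. e s * h s z) =
      (\<Sum>(t, s)\<in>I \<times> J. c t * e s * (f t y * h s z))" for y z
    unfolding sum_product sum.cartesian_product by (intro sum.cong) (auto simp: mult_ac)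
  then have "gr_mult \<Gamma> (\<lambda>x. \<Sum>t\<in>I. c t * f t x) (\<lambda>x. \<Sum>s\<in>J. e s * h s x) x =
      (\<Sum>y\<in>carrier \<Gamma>. \<Sum>(t, s)\<in>I \<times> J. c t * e s * (f t y * h s (inv\<^bsub>\<Gamma>\<^esub> y \<otimes>\<^bsub>\<Gamma>\<^esub> x)))"
    using True by (simp add: gr_mult_def)
  also have "\<dots> = (\<Sum>(t, s)\<in>I \<times> J. c t * e s * gr_mult \<Gamma> (f t) (h s) x)"
    using True by (subst sum.swap) (simp add: gr_mult_def sum_distrib_left case_prod_unfold)
  finally show ?thesis .
qed (simp add: gr_mult_def)

lemma gr_mat_mult_lincomb:
  assumes "finite I" "finite J"
    and "\<And>t. t \<in> I \<Longrightarrow> M t \<in> carrier_mat n n" "\<And>s. s \<in> J \<Longrightarrow> N s \<in> carrier_mat n n"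
  shows "gr_mat_mult \<Gamma> (gr_lincomb n I c M) (gr_lincomb n J e N) =
    gr_lincomb n (I \<times> J) (\<lambda>(t, s). c t * e s) (\<lambda>(t, s). gr_mat_mult \<Gamma> (M t) (N s))"
proof (rule eq_matI)
  fix i j
  assume "i < dim_row (gr_lincomb n (I \<times> J) (\<lambda>(t, s). c t * e s) (\<lambda>(t, s). gr_mat_mult \<Gamma> (M t) (N s)))"
    "j < dim_col (gr_lincomb n (I \<times> J) (\<lambda>(t, s). c t * e s) (\<lambda>(t, s). gr_mat_mult \<Gamma> (M t) (N s)))"
  then have ij: "i < n" "j < n" by (auto simp: gr_lincomb_def)
  have "(\<Sum>k<n. gr_mult \<Gamma> (gr_lincomb n I c M $$ (i, k)) (gr_lincomb n J e N $$ (k, j)) x) =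
      (\<Sum>p\<in>I \<times> J. (case p of (t, s) \<Rightarrow> c t * e s) *
        ((case p of (t, s) \<Rightarrow> gr_mat_mult \<Gamma> (M t) (N s)) $$ (i, j)) x)" for x
  proof -
    have "(\<Sum>k<n. gr_mult \<Gamma> (gr_lincomb n I c M $$ (i, k)) (gr_lincomb n J e N $$ (k, j)) x) =
        (\<Sum>k<n. \<Sum>(t, s)\<in>I \<times> J. c t * e s * gr_mult \<Gamma> (M t $$ (i, k)) (N s $$ (k, j)) x)"
      using ij by (intro sum.cong refl) (simp add: gr_lincomb_def gr_mult_sum[OF assms(1,2)])
    also have "\<dots> = (\<Sum>(t, s)\<in>I \<times> J. c t * e s * (\<Sum>k<n. gr_mult \<Gamma> (M t $$ (i, k)) (N s $$ (k, j)) x))"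
      by (subst sum.swap) (simp add: sum_distrib_left case_prod_unfold)
    also have "\<dots> = (\<Sum>p\<in>I \<times> J. (case p of (t, s) \<Rightarrow> c t * e s) *
        ((case p of (t, s) \<Rightarrow> gr_mat_mult \<Gamma> (M t) (N s)) $$ (i, j)) x)"
    proof (intro sum.cong refl)
      fix p assume "p \<in> I \<times> J"
      then have "M (fst p) \<in> carrier_mat n n" "N (snd p) \<in> carrier_mat n n" using assms by auto
      then show "(case p of (t, s) \<Rightarrow> c t * e s * (\<Sum>k<n. gr_mult \<Gamma> (M t $$ (i, k)) (N s $$ (k, j)) x)) =
          (case p of (t, s) \<Rightarrow> c t * e s) *
          ((case p of (t, s) \<Rightarrow> gr_mat_mult \<Gamma> (M t) (N s)) $$ (i, j)) x"
        using ij by (auto simp: gr_mat_mult_def case_prod_unfold)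
    qed
    finally show ?thesis .
  qed
  moreover have "dim_row (gr_lincomb n I c M) = n" "dim_col (gr_lincomb n I c M) = n"
    "dim_col (gr_lincomb n J e N) = n" by (auto simp: gr_lincomb_def)
  ultimately show "gr_mat_mult \<Gamma> (gr_lincomb n I c M) (gr_lincomb n J e N) $$ (i, j) =
      gr_lincomb n (I \<times> J) (\<lambda>(t, s). c t * e s) (\<lambda>(t, s). gr_mat_mult \<Gamma> (M t) (N s)) $$ (i, j)"
    using ij unfolding gr_mat_mult_def by (simp add: gr_lincomb_def[of n "I \<times> J"])
qed (auto simp: gr_mat_mult_def gr_lincomb_def)

text \<open>By bilinearity of the product, closure has to be checked on the generators only.\<close>

lemma gr_span_mult_closed:
  assumes \<A>: "\<A> \<subseteq> carrier_mat n n"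
    and gens: "\<And>M N. \<lbrakk>M \<in> \<A>; N \<in> \<A>\<rbrakk> \<Longrightarrow> gr_mat_mult \<Gamma> M N \<in> gr_span n \<A>"
    and "X \<in> gr_span n \<A>" "Y \<in> gr_span n \<A>"
  shows "gr_mat_mult \<Gamma> X Y \<in> gr_span n \<A>"
proof -
  obtain F c where F: "X = gr_lincomb n F c (\<lambda>M. M)" "finite F" "F \<subseteq> \<A>"
    using assms(3) unfolding gr_span_eq by blast
  obtain G e where G: "Y = gr_lincomb n G e (\<lambda>M. M)" "finite G" "G \<subseteq> \<A>"
    using assms(4) unfolding gr_span_eq by blast
  have "gr_mat_mult \<Gamma> X Y =
      gr_lincomb n (F \<times> G) (\<lambda>(t, s). c t * e s) (\<lambda>(t, s). gr_mat_mult \<Gamma> t s)"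
    unfolding F(1) G(1) using F G \<A> by (intro gr_mat_mult_lincomb) auto
  also have "\<dots> \<in> gr_span n \<A>"
    using F G gens by (intro gr_lincomb_span) auto
  finally show ?thesis .
qed

lemma (in group) gr_mult_gr_of:
  assumes fin: "finite (carrier G)" and g: "g \<in> carrier G" and h: "h \<in> carrier G"
  shows "gr_mult G (gr_of g) (gr_of h) = gr_of (g \<otimes> h)"
proof
  fix x
  show "gr_mult G (gr_of g) (gr_of h) x = gr_of (g \<otimes> h) x"
  proof (cases "x \<in> carrier G")
    case True
    have "gr_mult G (gr_of g) (gr_of h) x =
        (\<Sum>y\<in>carrier G. if y = g then gr_of h (inv g \<otimes> x) else 0)"
      using True unfolding gr_mult_def by (auto simp: gr_of_def intro!: sum.cong)
    also have "\<dots> = gr_of h (inv g \<otimes> x)" using fin g by simp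
    also have "\<dots> = gr_of (g \<otimes> h) x"
      using inv_solve_left'[OF h g True] by (simp add: gr_of_def)
    finally show ?thesis .
  qed (use g h in \<open>auto simp: gr_mult_def gr_of_def\<close>)
qed

section \<open>Condition (R4) from the counts\<close>

context roux_drackn
begin

abbreviation (input) tI :: "'g \<Rightarrow> ('g \<Rightarrow> complex) mat" where
  "tI g \<equiv> gr_translate \<Gamma> g (gr_one_mat \<Gamma> n)"

abbreviation (input) tB :: "'g \<Rightarrow> ('g \<Rightarrow> complex) mat" where
  "tB g \<equiv> gr_translate \<Gamma> g rmat"

lemma translate_carrier: "tI g \<in> carrier_mat n n" "tB g \<in> carrier_mat n n"
  by (auto simp: gr_translate_def gr_one_mat_def rmat_def)

lemma translate_index:
  assumes "g \<in> carrier \<Gamma>" "i < n" "j < n"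
  shows "tI g $$ (i, j) = (if i = j then gr_of g else (\<lambda>_. 0))"
    "tB g $$ (i, j) = (if i = j then (\<lambda>_. 0) else gr_of (g \<otimes> b i j))"
  using assms b_closed
  by (auto simp: gr_translate_def gr_one_mat_def rmat_def gr_mult_zero gr_mult_gr_of finite_carrier)

lemma gr_mat_mult_eqI:
  assumes "X \<in> carrier_mat n n" "Y \<in> carrier_mat n n" "Z \<in> carrier_mat n n"
    and "\<And>i j x. \<lbrakk>i < n; j < n\<rbrakk> \<Longrightarrow>
      (\<Sum>k<n. gr_mult \<Gamma> (X $$ (i, k)) (Y $$ (k, j)) x) = (Z $$ (i, j)) x"
  shows "gr_mat_mult \<Gamma> X Y = Z"
  using assms by (intro eq_matI) (auto simp: gr_mat_mult_def)

lemma mult_tI: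
  assumes g: "g \<in> carrier \<Gamma>" and h: "h \<in> carrier \<Gamma>"
  shows "gr_mat_mult \<Gamma> (tI g) (tI h) = tI (g \<otimes> h)"
    "gr_mat_mult \<Gamma> (tI g) (tB h) = tB (g \<otimes> h)"
    "gr_mat_mult \<Gamma> (tB g) (tI h) = tB (g \<otimes> h)"
proof -
  have gh: "g \<otimes> h \<in> carrier \<Gamma>" using g h by simp
  show "gr_mat_mult \<Gamma> (tI g) (tI h) = tI (g \<otimes> h)"
  proof (rule gr_mat_mult_eqI[OF translate_carrier(1) translate_carrier(1) translate_carrier(1)])
    fix i j x assume ij: "i < n" "j < n"
    have "(\<Sum>k<n. gr_mult \<Gamma> (tI g $$ (i, k)) (tI h $$ (k, j)) x) =
        (\<Sum>k<n. if k = i then (tI (g \<otimes> h) $$ (i, j)) x else 0)"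
      using ij g h gh
      by (intro sum.cong) (auto simp: translate_index gr_mult_zero gr_mult_gr_of finite_carrier)
    then show "(\<Sum>k<n. gr_mult \<Gamma> (tI g $$ (i, k)) (tI h $$ (k, j)) x) = (tI (g \<otimes> h) $$ (i, j)) x"
      using ij by simp
  qed
  show "gr_mat_mult \<Gamma> (tI g) (tB h) = tB (g \<otimes> h)"
  proof (rule gr_mat_mult_eqI[OF translate_carrier(1) translate_carrier(2) translate_carrier(2)])
    fix i j x assume ij: "i < n" "j < n"
    have "(\<Sum>k<n. gr_mult \<Gamma> (tI g $$ (i, k)) (tB h $$ (k, j)) x) =
        (\<Sum>k<n. if k = i then (tB (g \<otimes> h) $$ (i, j)) x else 0)"
      using ij g h gh b_closed
      by (intro sum.cong)
        (auto simp: translate_index gr_mult_zero gr_mult_gr_of finite_carrier m_assoc)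
    then show "(\<Sum>k<n. gr_mult \<Gamma> (tI g $$ (i, k)) (tB h $$ (k, j)) x) = (tB (g \<otimes> h) $$ (i, j)) x"
      using ij by simp
  qed
  show "gr_mat_mult \<Gamma> (tB g) (tI h) = tB (g \<otimes> h)"
  proof (rule gr_mat_mult_eqI[OF translate_carrier(2) translate_carrier(1) translate_carrier(2)])
    fix i j x assume ij: "i < n" "j < n"
    have "(\<Sum>k<n. gr_mult \<Gamma> (tB g $$ (i, k)) (tI h $$ (k, j)) x) =
        (\<Sum>k<n. if k = j then (tB (g \<otimes> h) $$ (i, j)) x else 0)"
      using ij g h gh b_closed[OF ij]
      by (intro sum.cong)
        (auto simp: translate_index gr_mult_zero gr_mult_gr_of finite_carrier m_ac)
    then show "(\<Sum>k<n. gr_mult \<Gamma> (tB g $$ (i, k)) (tI h $$ (k, j)) x) = (tB (g \<otimes> h) $$ (i, j)) x"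
      using ij by simp
  qed
qed

text \<open>The counts express the square of B as (n - 1) I plus c times the sum of all yB plus (a -
  c) B; multiplying by g \<otimes> h moves the special coefficient to y = g \<otimes> h. The index
  \<open>None\<close> carries the identity term and \<open>Some y\<close> the term yB.\<close>

lemma mult_tB:
  assumes g: "g \<in> carrier \<Gamma>" and h: "h \<in> carrier \<Gamma>"
  shows "gr_mat_mult \<Gamma> (tB g) (tB h) =
    gr_lincomb n (insert None (Some ` carrier \<Gamma>))
      (case_option (of_nat (n - 1)) (\<lambda>y. of_nat (if y = g \<otimes> h then a else c)))
      (case_option (tI (g \<otimes> h)) tB)"
    (is "_ = gr_lincomb n ?I ?c ?M")
proof (rule gr_mat_mult_eqI[OF translate_carrier(2) translate_carrier(2)])
  show "gr_lincomb n ?I ?c ?M \<in> carrier_mat n n" by (simp add: gr_lincomb_def)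
  have gh: "g \<otimes> h \<in> carrier \<Gamma>" using g h by simp
  fix i j x assume ij: "i < n" "j < n"
  have prod: "(\<Sum>k<n. gr_mult \<Gamma> (tB g $$ (i, k)) (tB h $$ (k, j)) x) =
      of_nat (card {k. k < n \<and> k \<noteq> i \<and> k \<noteq> j \<and> x = g \<otimes> h \<otimes> (b i k \<otimes> b k j)})"
  proof -
    have "(\<Sum>k<n. gr_mult \<Gamma> (tB g $$ (i, k)) (tB h $$ (k, j)) x) =
        (\<Sum>k<n. if k \<noteq> i \<and> k \<noteq> j \<and> x = g \<otimes> h \<otimes> (b i k \<otimes> b k j) then 1 else 0)"
    proof (intro sum.cong refl)
      fix k assume "k \<in> {..<n}"
      then have k: "k < n" by simp
      show "gr_mult \<Gamma> (tB g $$ (i, k)) (tB h $$ (k, j)) x =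
          (if k \<noteq> i \<and> k \<noteq> j \<and> x = g \<otimes> h \<otimes> (b i k \<otimes> b k j) then 1 else 0)"
      proof (cases "k = i \<or> k = j")
        case True
        then show ?thesis using g h ij k by (auto simp: translate_index gr_mult_zero)
      next
        case False
        then have b: "b i k \<in> carrier \<Gamma>" "b k j \<in> carrier \<Gamma>" using b_closed ij k by auto
        have "gr_mult \<Gamma> (tB g $$ (i, k)) (tB h $$ (k, j)) = gr_of (g \<otimes> b i k \<otimes> (h \<otimes> b k j))"
          using False g h ij k b by (simp add: translate_index gr_mult_gr_of finite_carrier)
        also have "g \<otimes> b i k \<otimes> (h \<otimes> b k j) = g \<otimes> h \<otimes> (b i k \<otimes> b k j)"
          using g h b by (simp add: m_ac)
        finally show ?thesis using False by (simp add: gr_of_def)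
      qed
    qed
    also have "\<dots> = of_nat (card {k \<in> {..<n}. k \<noteq> i \<and> k \<noteq> j \<and> x = g \<otimes> h \<otimes> (b i k \<otimes> b k j)})"
      by (simp add: sum.If_cases Int_def)
    finally show ?thesis by simp
  qed
  have lc: "(gr_lincomb n ?I ?c ?M $$ (i, j)) x =
      of_nat (n - 1) * (tI (g \<otimes> h) $$ (i, j)) x +
      (\<Sum>y\<in>carrier \<Gamma>. of_nat (if y = g \<otimes> h then a else c) * (tB y $$ (i, j)) x)"
    using ij finite_carrier by (simp add: gr_lincomb_def sum.reindex inj_on_def)
  show "(\<Sum>k<n. gr_mult \<Gamma> (tB g $$ (i, k)) (tB h $$ (k, j)) x) = (gr_lincomb n ?I ?c ?M $$ (i, j)) x"
  proof (cases "x \<in> carrier \<Gamma>")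
    case False
    then have "x \<noteq> g \<otimes> h \<otimes> (b i k \<otimes> b k j)" if "k < n" "k \<noteq> i" "k \<noteq> j" for k
      using that g h ij b_closed by auto
    moreover have "(tI (g \<otimes> h) $$ (i, j)) x = 0" "(tB y $$ (i, j)) x = 0" if "y \<in> carrier \<Gamma>" for y
      using False that gh ij b_closed by (auto simp: translate_index gr_of_def)
    ultimately show ?thesis unfolding prod lc using gh by (auto simp: card_eq_0_iff)
  next
    case x: True
    have shift: "x = g \<otimes> h \<otimes> z \<longleftrightarrow> z = inv (g \<otimes> h) \<otimes> x" if "z \<in> carrier \<Gamma>" for z
      using inv_solve_left[OF that gh x] by blast
    have "{k. k < n \<and> k \<noteq> i \<and> k \<noteq> j \<and> x = g \<otimes> h \<otimes> (b i k \<otimes> b k j)} =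
        middle i j (inv (g \<otimes> h) \<otimes> x)"
      unfolding middle_def
    proof (intro Collect_cong conj_cong refl)
      fix k assume "k < n" "k \<noteq> i" "k \<noteq> j"
      then show "x = g \<otimes> h \<otimes> (b i k \<otimes> b k j) \<longleftrightarrow> b i k \<otimes> b k j = inv (g \<otimes> h) \<otimes> x"
        using ij b_closed by (intro shift) simp
    qed
    then have prod': "(\<Sum>k<n. gr_mult \<Gamma> (tB g $$ (i, k)) (tB h $$ (k, j)) x) =
        of_nat (card (middle i j (inv (g \<otimes> h) \<otimes> x)))" using prod by simp
    show ?thesis
    proof (cases "i = j")
      case True
      have "inv (g \<otimes> h) \<otimes> x = \<one> \<longleftrightarrow> x = g \<otimes> h" using shift[OF one_closed] r_one[OF gh] by metis
      then show ?thesis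
        unfolding prod' lc using True ij gh by (auto simp: middle_diagonal translate_index gr_of_def)
    next
      case False
      have bij: "b i j \<in> carrier \<Gamma>" by (rule b_closed[OF ij False])
      \<comment> \<open>At \<open>x\<close> only the translate with y = x \<otimes> inv (b i j)
        contributes.\<close>
      have "(\<Sum>y\<in>carrier \<Gamma>. of_nat (if y = g \<otimes> h then a else c) * (tB y $$ (i, j)) x) =
          (\<Sum>y\<in>carrier \<Gamma>. gr_of (x \<otimes> inv (b i j)) y * of_nat (if y = g \<otimes> h then a else c))"
        using False ij x bij inv_solve_right[of _ x "b i j"]
        by (intro sum.cong) (auto simp: translate_index gr_of_def)
      also have "\<dots> = of_nat (if x \<otimes> inv (b i j) = g \<otimes> h then a else c)"
        using x bij by (intro sum_gr_of) simp
      also have "x \<otimes> inv (b i j) = g \<otimes> h \<longleftrightarrow> inv (g \<otimes> h) \<otimes> x = b i j"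
        using shift[OF bij] inv_solve_right[OF gh x bij] by metis
      finally show ?thesis
        unfolding prod' lc using False ij gh x by (simp add: translate_index counts)
    qed
  qed
qed

lemma roux_rmat: "roux \<Gamma> n rmat"
proof -
  define \<A> where "\<A> = tI ` carrier \<Gamma> \<union> tB ` carrier \<Gamma>"
  have \<A>: "\<A> \<subseteq> carrier_mat n n" unfolding \<A>_def using translate_carrier by blast
  have gen: "tI g \<in> gr_span n \<A>" "tB g \<in> gr_span n \<A>" if "g \<in> carrier \<Gamma>" for g
    using that translate_carrier by (auto simp: \<A>_def intro!: gr_span_generator)
  have BB: "gr_mat_mult \<Gamma> (tB g) (tB h) \<in> gr_span n \<A>"
    if "g \<in> carrier \<Gamma>" "h \<in> carrier \<Gamma>" for g h
    unfolding mult_tB[OF that] using that gen finite_carrier by (intro gr_lincomb_span) auto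
  have "gr_mat_mult \<Gamma> M N \<in> gr_span n \<A>" if MN: "M \<in> \<A>" "N \<in> \<A>" for M N
  proof -
    obtain g h where gh: "g \<in> carrier \<Gamma>" "h \<in> carrier \<Gamma>" "M = tI g \<or> M = tB g" "N = tI h \<or> N = tB h"
    proof -
      have "\<exists>g\<in>carrier \<Gamma>. M = tI g \<or> M = tB g" "\<exists>h\<in>carrier \<Gamma>. N = tI h \<or> N = tB h"
        using MN unfolding \<A>_def by auto
      then show thesis using that by metis
    qed
    then have "g \<otimes> h \<in> carrier \<Gamma>" by simp
    then show ?thesis using gh mult_tI[OF gh(1,2)] BB[OF gh(1,2)] gen by auto
  qed
  then have closed: "\<forall>X\<in>gr_span n \<A>. \<forall>Y\<in>gr_span n \<A>. gr_mat_mult \<Gamma> X Y \<in> gr_span n \<A>"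
    using gr_span_mult_closed[OF \<A>] by blast
  show ?thesis
    unfolding roux_def Let_def \<A>_def[symmetric]
  proof (intro conjI allI impI ballI)
    fix i j assume ij: "i < n" "j < n"
    show "rmat $$ (i, j) \<in> gr_carrier \<Gamma>"
      using b_closed[OF ij] by (auto simp: rmat_index[OF ij] gr_carrier_def gr_of_def)
    show "rmat $$ (i, j) \<in> gr_of ` carrier \<Gamma>" if "i \<noteq> j"
      using b_closed[OF ij that] that by (simp add: rmat_index[OF ij])
    show "rmat $$ (j, i) = gr_of (inv g)" if "i \<noteq> j" "rmat $$ (i, j) = gr_of g" for g
      using that b_inverse[OF ij that(1)] by (simp add: rmat_index ij gr_of_eq_iff)
  qed (use closed comm_group_axioms finite_carrier in \<open>simp_all add: rmat_def\<close>)
qed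

end

section \<open>Distances in the roux graph\<close>

context roux_drackn
begin

abbreviation adj :: "nat \<times> 'g \<Rightarrow> nat \<times> 'g \<Rightarrow> bool" where
  "adj u v \<equiv> (u, v) \<in> parcs rgraph"

lemma adj_sym: "adj u v \<Longrightarrow> adj v u"
  by (rule rg.arcs_symmetric)

lemma adj_fst_neq: "adj u v \<Longrightarrow> fst u \<noteq> fst v"
  by (cases u; cases v) (simp add: parcs_rgraph)

lemma unique_neighbour:
  assumes u: "u \<in> pverts rgraph" and j: "j < n" "j \<noteq> fst u"
  obtains w where "w \<in> pverts rgraph" "fst w = j" "adj u w" "\<And>w'. \<lbrakk>adj u w'; fst w' = j\<rbrakk> \<Longrightarrow> w' = w"
proof -
  obtain i g where ig: "u = (i, g)" "i < n" "g \<in> carrier \<Gamma>" using u by (auto simp: pverts_rgraph)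
  have ij: "i \<noteq> j" using j ig by simp
  have adj_iff: "adj u (j, h) \<longleftrightarrow> h = b j i \<otimes> g" if "h \<in> carrier \<Gamma>" for h
    using b_swap[OF ig(2) j(1) ij ig(3) that] ig ij j that by (simp add: parcs_rgraph)
  have c: "b j i \<otimes> g \<in> carrier \<Gamma>" using ig j ij b_closed by simp
  show thesis
  proof (rule that[of "(j, b j i \<otimes> g)"])
    show "(j, b j i \<otimes> g) \<in> pverts rgraph" using c j by (simp add: pverts_rgraph)
    show "adj u (j, b j i \<otimes> g)" using adj_iff[OF c] by simp
    show "w' = (j, b j i \<otimes> g)" if w': "adj u w'" "fst w' = j" for w'
    proof -
      obtain h where h: "w' = (j, h)" using w'(2) by (cases w') auto
      then have "h \<in> carrier \<Gamma>" using rg.in_arcsD2[OF w'(1)] by (simp add: pverts_rgraph)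
      then show ?thesis using adj_iff[of h] w'(1) h by simp
    qed
  qed simp
qed

lemma card_common_neighbours:
  assumes "u \<in> pverts rgraph" "v \<in> pverts rgraph"
  shows "card {w. adj u w \<and> adj v w} =
    (if u = v then n - 1 else if fst u = fst v then 0 else if adj u v then a else c)"
proof -
  obtain i g j h where uv: "u = (i, g)" "v = (j, h)" "i < n" "j < n" "g \<in> carrier \<Gamma>" "h \<in> carrier \<Gamma>"
    using assms by (auto simp: pverts_rgraph)
  have one: "g \<otimes> inv h = \<one> \<longleftrightarrow> g = h"
    using inv_solve_right[OF one_closed uv(5,6)] uv(6) by auto
  have card: "card {w. adj u w \<and> adj v w} = card (middle i j (g \<otimes> inv h))"
    unfolding uv(1,2) by (rule common_neighbours[OF uv(3-6)])
  show ?thesis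
  proof (cases "i = j")
    case True
    then show ?thesis using card uv one by (simp add: middle_diagonal)
  next
    case False
    then show ?thesis
      using card uv counts[OF uv(3,4) False, of "g \<otimes> inv h"] b_times_inv_iff[OF uv(3,4) False uv(5,6)]
      by (simp add: parcs_rgraph)
  qed
qed

lemma common_neighbour_exists:
  assumes "u \<in> pverts rgraph" "v \<in> pverts rgraph" "fst u \<noteq> fst v" "\<not> adj u v"
  shows "\<exists>w. adj u w \<and> adj w v"
proof -
  have "card {w. adj u w \<and> adj v w} > 0"
    using card_common_neighbours[OF assms(1,2)] assms(3,4) c_pos by auto
  then have "{w. adj u w \<and> adj v w} \<noteq> {}" by (metis card.empty less_irrefl)
  then show ?thesis using adj_sym by blast
qed

text \<open>\<open>middle i i x\<close> is empty unless x = \<one>. This keeps distinct vertices of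
  one fibre further apart than 2.\<close>

lemma no_common_neighbour:
  assumes "adj u w" "adj w v" "fst u = fst v"
  shows "u = v"
proof (rule ccontr)
  assume "u \<noteq> v"
  then have "card {w. adj u w \<and> adj v w} = 0"
    using assms card_common_neighbours[of u v] rg.in_arcsD1[OF assms(1)] rg.in_arcsD2[OF assms(2)]
    by simp
  moreover have "finite {w. adj u w \<and> adj v w}"
    by (rule finite_subset[OF _ rg.pair_finite_verts]) (use rg.in_arcsD2 in blast)
  moreover have "w \<in> {w. adj u w \<and> adj v w}" using assms adj_sym by blast
  ultimately show False using card_0_eq by blast
qed

text \<open>Nonadjacent vertices of distinct fibres are joined through a common neighbour because c
  > 0. Distinct vertices of one fibre have none, but a neighbour of the first lies in another fibre
  and hence within distance 2 of the second.\<close>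

lemma dist_le:
  assumes u: "u \<in> pverts rgraph" and v: "v \<in> pverts rgraph"
  shows "graph_dist rgraph u v \<le> enat 0 \<longleftrightarrow> u = v"
    "graph_dist rgraph u v \<le> enat 1 \<longleftrightarrow> u = v \<or> adj u v"
    "graph_dist rgraph u v \<le> enat 2 \<longleftrightarrow> u = v \<or> fst u \<noteq> fst v"
    "graph_dist rgraph u v \<le> enat 3"
proof -
  have le0: "graph_dist rgraph w v \<le> enat 0 \<longleftrightarrow> w = v" for w
    using graph_dist_le_0_iff[of rgraph w v] v by (auto simp: zero_enat_def)
  have le1: "graph_dist rgraph w v \<le> enat (Suc 0) \<longleftrightarrow> w = v \<or> adj w v" for w
    unfolding rg.graph_dist_le_Suc_iff le0 using v by blast
  have le2: "graph_dist rgraph w v \<le> enat (Suc (Suc 0)) \<longleftrightarrow> w = v \<or> fst w \<noteq> fst v"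
    if w: "w \<in> pverts rgraph" for w
  proof -
    have "graph_dist rgraph w v \<le> enat (Suc (Suc 0)) \<longleftrightarrow> w = v \<or> adj w v \<or> (\<exists>x. adj w x \<and> adj x v)"
      unfolding rg.graph_dist_le_Suc_iff[of w v "Suc 0"] le1 using w by blast
    then show ?thesis
      using adj_fst_neq no_common_neighbour common_neighbour_exists[OF w v] by metis
  qed
  show "graph_dist rgraph u v \<le> enat 0 \<longleftrightarrow> u = v" by (rule le0)
  show "graph_dist rgraph u v \<le> enat 1 \<longleftrightarrow> u = v \<or> adj u v" using le1 by simp
  show "graph_dist rgraph u v \<le> enat 2 \<longleftrightarrow> u = v \<or> fst u \<noteq> fst v"
    using le2[OF u] by (simp add: numeral_2_eq_2)
  \<comment> \<open>A fibre for the first step away from \<open>u\<close>; for u and v in one fibre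
    it exists because n \<ge> 2.\<close>
  obtain j where j: "j < n" "j \<noteq> fst u" "j = fst v \<or> fst u = fst v"
  proof (cases "fst u = fst v")
    case True
    have "(if fst u = 0 then 1 else 0) < n" "(if fst u = 0 then 1 else 0) \<noteq> fst u" using n_ge_2 by auto
    then show thesis using True that by blast
  next
    case False
    then show thesis using v that[of "fst v"] by (auto simp: pverts_rgraph)
  qed
  show "graph_dist rgraph u v \<le> enat 3"
  proof (cases "fst u = fst v")
    case True
    obtain w where w: "w \<in> pverts rgraph" "fst w = j" "adj u w" using unique_neighbour[OF u j(1,2)] by metis
    then have "graph_dist rgraph w v \<le> enat (Suc (Suc 0))" using le2[OF w(1)] True j by auto
    then show ?thesis
      unfolding numeral_3_eq_3 rg.graph_dist_le_Suc_iff[of u v "Suc (Suc 0)"] using w(3) by blast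
  next
    case False
    then have "graph_dist rgraph u v \<le> enat (Suc (Suc 0))" using le2[OF u] by blast
    also have "enat (Suc (Suc 0)) \<le> enat 3" by simp
    finally show ?thesis .
  qed
qed

lemma dist_eq:
  assumes u: "u \<in> pverts rgraph" and v: "v \<in> pverts rgraph"
  shows "graph_dist rgraph u v =
    (if u = v then 0 else if fst u = fst v then 3 else if adj u v then 1 else 2)"
proof -
  obtain k where k: "graph_dist rgraph u v = enat k" "k \<le> 3"
    using dist_le(4)[OF u v] by (cases "graph_dist rgraph u v") auto
  have iffs: "k = 0 \<longleftrightarrow> u = v" "k \<le> 1 \<longleftrightarrow> u = v \<or> adj u v" "k \<le> 2 \<longleftrightarrow> u = v \<or> fst u \<noteq> fst v"
    using dist_le(1-3)[OF u v] unfolding k(1) by auto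
  have "k = (if u = v then 0 else if fst u = fst v then 3 else if adj u v then 1 else 2)"
    using iffs k(2) adj_fst_neq[of u v] by (auto split: if_splits)
  then show ?thesis unfolding k(1) by (auto simp: zero_enat_def one_enat_def numeral_eq_enat)
qed

lemma cover_rgraph: "cover_of_complete_graph rgraph (roux_fibres \<Gamma> n)"
  unfolding cover_of_complete_graph_def
proof (intro conjI ballI impI)
  show "pair_graph rgraph" by (rule pair_graph_rgraph)
  show "partition_on (pverts rgraph) (roux_fibres \<Gamma> n)"
    using one_closed by (intro partition_onI) (auto simp: pverts_rgraph roux_fibres_def disjnt_def)
  fix F assume F: "F \<in> roux_fibres \<Gamma> n"
  then obtain i where i: "i < n" "F = {i} \<times> carrier \<Gamma>" by (auto simp: roux_fibres_def)
  show "(u, v) \<notin> parcs rgraph" if "u \<in> F" "v \<in> F" for u v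
    using that adj_fst_neq[of u v] i by auto
  fix F' u assume F': "F' \<in> roux_fibres \<Gamma> n" "F \<noteq> F'" and u: "u \<in> F \<union> F'"
  then obtain j where j: "j < n" "F' = {j} \<times> carrier \<Gamma>" by (auto simp: roux_fibres_def)
  have ij: "i \<noteq> j" using F'(2) i j by blast
  have uV: "u \<in> pverts rgraph" using u i j by (auto simp: pverts_rgraph)
  define l where "l = (if fst u = i then j else i)"
  have l: "l < n" "l \<noteq> fst u" using i j ij u by (auto simp: l_def)
  obtain w where w: "w \<in> pverts rgraph" "fst w = l" "adj u w"
    "\<And>w'. \<lbrakk>adj u w'; fst w' = l\<rbrakk> \<Longrightarrow> w' = w"
    using unique_neighbour[OF uV l] by metis
  have mem: "x \<in> F \<union> F' \<longleftrightarrow> x \<in> pverts rgraph \<and> (fst x = i \<or> fst x = j)" for x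
    using i j by (cases x) (auto simp: pverts_rgraph)
  show "\<exists>!v. v \<in> F \<union> F' \<and> (u, v) \<in> parcs rgraph"
  proof (rule ex1I[of _ w])
    show "w \<in> F \<union> F' \<and> (u, w) \<in> parcs rgraph"
      using w(1-3) mem[of w] unfolding l_def by metis
    fix v assume v: "v \<in> F \<union> F' \<and> (u, v) \<in> parcs rgraph"
    then have "fst v = l"
      using adj_fst_neq[of u v] u mem[of u] mem[of v] unfolding l_def by metis
    then show "v = w" using w(4) v by blast
  qed
qed

lemma connected_rgraph: "Digraph_Component.connected (with_proj rgraph)"
proof -
  have "(0, \<one>) \<in> pverts rgraph" using n_ge_2 by (simp add: pverts_rgraph)
  moreover have "u \<rightarrow>\<^sup>*\<^bsub>mk_symmetric (with_proj rgraph)\<^esub> v" if uv: "u \<in> pverts rgraph" "v \<in> pverts rgraph" for u v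
  proof -
    obtain p where "pre_digraph.awalk (with_proj rgraph) u p v"
      using dist_le(4)[OF uv] unfolding graph_dist_le_iff by blast
    then have "u \<rightarrow>\<^sup>*\<^bsub>with_proj rgraph\<^esub> v" by (rule rg.reachable_awalkI)
    then show ?thesis by (rule rg.reachable_mk_symmetricI)
  qed
  ultimately show ?thesis
    unfolding Digraph_Component.connected_def strongly_connected_def by auto
qed

text \<open>Distance 3 occurs only between distinct vertices of one fibre, which is where
  \<open>nontrivial\<close> enters.\<close>

lemma diameter_rgraph: "graph_diameter rgraph = 3"
proof (rule antisym)
  show "graph_diameter rgraph \<le> 3"
    unfolding graph_diameter_def using dist_le(4)
    by (intro SUP_least) (auto simp: numeral_eq_enat)
  obtain g where g: "g \<in> carrier \<Gamma>" "g \<noteq> \<one>" using nontrivial by blast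
  then have V: "(0, \<one>) \<in> pverts rgraph" "(0, g) \<in> pverts rgraph" using n_ge_2 by (auto simp: pverts_rgraph)
  then have "graph_dist rgraph (0, \<one>) (0, g) = 3" using g dist_eq[OF V] by auto
  then show "3 \<le> graph_diameter rgraph"
    unfolding graph_diameter_def using V by (intro SUP_upper2[of "((0, \<one>), (0, g))"]) auto
qed

text \<open>The four distance relations lie in the span of equality, adjacency, the fibre relation and the
  all-one relation, so it is enough to count common successors for pairs of these.\<close>

definition base :: "nat \<Rightarrow> nat \<times> 'g \<Rightarrow> nat \<times> 'g \<Rightarrow> int" where
  "base p u w = (if p = 0 then of_bool (u = w) else if p = 1 then of_bool (adj u w)
    else if p = 2 then of_bool (fst u = fst w) else 1)"

text \<open>Distance 3 is the fibre relation minus equality; distance 2 is what the fibre and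
  adjacency relations leave of the all-one relation. Other distances do not occur.\<close>

definition rel_coeff :: "enat \<Rightarrow> nat \<Rightarrow> int" where
  "rel_coeff i p = (if i = 0 then of_bool (p = 0) else if i = 1 then of_bool (p = 1)
    else if i = 3 then of_bool (p = 2) - of_bool (p = 0)
    else if i = 2 then of_bool (p = 3) - of_bool (p = 2) - of_bool (p = 1) else 0)"

lemma dist_indicator:
  assumes "u \<in> pverts rgraph" "w \<in> pverts rgraph"
  shows "of_bool (graph_dist rgraph u w = i) = (\<Sum>p<4. rel_coeff i p * base p u w)"
proof -
  have "(\<Sum>p<4. rel_coeff i p * base p u w) = rel_coeff i 0 * base 0 u w + rel_coeff i 1 * base 1 u w +
      rel_coeff i 2 * base 2 u w + rel_coeff i 3 * base 3 u w"
    by (simp add: eval_nat_numeral)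
  also have "\<dots> = of_bool (graph_dist rgraph u w = i)"
    using adj_fst_neq[of u w] unfolding dist_eq[OF assms]
    by (cases "u = w"; cases "fst u = fst w"; cases "adj u w") (auto simp: rel_coeff_def base_def)
  finally show ?thesis ..
qed

text \<open>For p, q < 4 this is the \<open>(u, v)\<close> entry of a product of two of the
  symmetric matrices I, A, F, J that belong to the base relations.\<close>

definition base_count :: "nat \<Rightarrow> nat \<Rightarrow> nat \<times> 'g \<Rightarrow> nat \<times> 'g \<Rightarrow> int" where
  "base_count p q u v = (\<Sum>w\<in>pverts rgraph. base p u w * base q v w)"

lemma base_count_commute: "base_count p q u v = base_count q p v u"
  by (simp add: base_count_def mult.commute)

lemma sum_of_bool_card: "(\<Sum>w\<in>pverts rgraph. of_bool (P w)) = int (card {w \<in> pverts rgraph. P w})"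
  using rg.pair_finite_verts by (simp add: sum.If_cases of_bool_def Int_def)

lemma base_count_0: "u \<in> pverts rgraph \<Longrightarrow> base_count 0 q u v = base q v u"
proof -
  assume u: "u \<in> pverts rgraph"
  have "base_count 0 q u v = (\<Sum>w\<in>pverts rgraph. if w = u then base q v u else 0)"
    unfolding base_count_def by (intro sum.cong) (auto simp: base_def)
  then show ?thesis using u rg.pair_finite_verts by simp
qed

text \<open>A F = J - F, because a vertex has exactly one neighbour in each other fibre and none in
  its own.\<close>

lemma base_count_adj_fibre:
  assumes "u \<in> pverts rgraph" "v \<in> pverts rgraph"
  shows "base_count 1 2 u v = of_bool (fst u \<noteq> fst v)"
proof -
  have "base_count 1 2 u v = int (card {w \<in> pverts rgraph. adj u w \<and> fst w = fst v})"
    unfolding base_count_def base_def sum_of_bool_card[symmetric] by (intro sum.cong) auto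
  also have "\<dots> = of_bool (fst u \<noteq> fst v)"
  proof (cases "fst u = fst v")
    case True
    then have "\<not> (adj u w \<and> fst w = fst v)" for w using adj_fst_neq[of u w] by metis
    then have "{w \<in> pverts rgraph. adj u w \<and> fst w = fst v} = {}" by blast
    then show ?thesis using True by (simp only: card.empty) simp
  next
    case False
    have "fst v < n" using assms(2) by (auto simp: pverts_rgraph)
    then obtain w where "w \<in> pverts rgraph" "fst w = fst v" "adj u w"
      "\<And>w'. \<lbrakk>adj u w'; fst w' = fst v\<rbrakk> \<Longrightarrow> w' = w"
      using unique_neighbour[OF assms(1), of "fst v"] False by metis
    then have "{w \<in> pverts rgraph. adj u w \<and> fst w = fst v} = {w}" by blast
    then show ?thesis using False by simp
  qed
  finally show ?thesis .
qed

lemma card_fibre: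
  assumes "u \<in> pverts rgraph"
  shows "card {w \<in> pverts rgraph. fst u = fst w} = card (carrier \<Gamma>)"
proof -
  have "{w \<in> pverts rgraph. fst u = fst w} = {fst u} \<times> carrier \<Gamma>"
    using assms by (auto simp: pverts_rgraph)
  then show ?thesis by (simp add: card_cartesian_product_singleton)
qed

text \<open>The span of I, A, F, J is closed under products: A A is given by the counts, A F = J -
  F, F F is a multiple of F, and products with J are multiples of J. Since the entries of I, A and F
  depend only on the distance, so do those of the products.\<close>

lemma base_count_eq:
  assumes V: "u \<in> pverts rgraph" "v \<in> pverts rgraph" "u' \<in> pverts rgraph" "v' \<in> pverts rgraph"
    and d: "graph_dist rgraph u v = graph_dist rgraph u' v'" and pq: "p < 4" "q < 4"
  shows "base_count p q u v = base_count p q u' v'"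
proof -
  have same: "u = v \<longleftrightarrow> u' = v'" "fst u = fst v \<longleftrightarrow> fst u' = fst v'" "adj u v \<longleftrightarrow> adj u' v'"
    using d adj_fst_neq[of u v] adj_fst_neq[of u' v'] unfolding dist_eq[OF V(1,2)] dist_eq[OF V(3,4)]
    by (auto split: if_splits)
  have same': "v = u \<longleftrightarrow> v' = u'" "fst v = fst u \<longleftrightarrow> fst v' = fst u'" "adj v u \<longleftrightarrow> adj v' u'"
    using same adj_sym by metis+
  have base: "base q v u = base q v' u'" "base p u v = base p u' v'" for p q
    using same same' by (simp_all add: base_def)
  have deg: "card {w \<in> pverts rgraph. adj x w} = n - 1" if "x \<in> pverts rgraph" for x
  proof -
    have "{w \<in> pverts rgraph. adj x w} = {w. adj x w \<and> adj x w}" using rg.in_arcsD2 by blast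
    then show ?thesis using card_common_neighbours[OF that that] by simp
  qed
  have adj_count: "base_count 1 1 x y = int (card {w. adj x w \<and> adj y w})" for x y
  proof -
    have "{w. adj x w \<and> adj y w} = {w \<in> pverts rgraph. adj x w \<and> adj y w}" using rg.in_arcsD2 by blast
    then show ?thesis
      unfolding base_count_def base_def using sum_of_bool_card[of "\<lambda>w. adj x w \<and> adj y w"]
      by (simp add: of_bool_conj)
  qed
  have one_count: "base_count 3 q x y = base_count 3 q x' y'"
    if "y \<in> pverts rgraph" "y' \<in> pverts rgraph" "q < 4" for x y x' y' q
  proof -
    consider "q = 0" | "q = 1" | "q = 2" | "q = 3" using \<open>q < 4\<close> by linarith
    then show ?thesis
    proof cases
      case 1
      then show ?thesis
        using base_count_commute[of 3 0] base_count_0[OF that(1), of 3 x] base_count_0[OF that(2), of 3 x']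
        by (simp add: base_def)
    next
      case 2
      then show ?thesis
        using sum_of_bool_card[of "adj y"] sum_of_bool_card[of "adj y'"] deg that
        by (simp add: base_count_def base_def)
    next
      case 3
      then show ?thesis
        using sum_of_bool_card[of "\<lambda>w. fst y = fst w"] sum_of_bool_card[of "\<lambda>w. fst y' = fst w"]
          card_fibre that
        by (simp add: base_count_def base_def)
    qed (simp add: base_count_def base_def)
  qed
  have fibre_count: "base_count 2 2 u v = base_count 2 2 u' v'"
  proof (cases "fst u = fst v")
    case True
    then have "base 2 u w * base 2 v w = of_bool (fst u = fst w)"
      "base 2 u' w * base 2 v' w = of_bool (fst u' = fst w)" for w
      using same(2) by (auto simp: base_def)
    then show ?thesis
      unfolding base_count_def using sum_of_bool_card[of "\<lambda>w. fst u = fst w"]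
        sum_of_bool_card[of "\<lambda>w. fst u' = fst w"] card_fibre V by simp
  next
    case False
    then have "base 2 u w * base 2 v w = 0" "base 2 u' w * base 2 v' w = 0" for w
      using same(2) by (auto simp: base_def)
    then show ?thesis unfolding base_count_def by simp
  qed
  consider "p = 0" | "q = 0" | "p = 3" | "q = 3" | "p = 1" "q = 1" | "p = 1" "q = 2" | "p = 2" "q = 1"
    | "p = 2" "q = 2" using pq by linarith
  then show ?thesis
  proof cases
    case 1
    then show ?thesis using base_count_0 V base by simp
  next
    case 2
    then show ?thesis using base_count_0 base_count_commute[of p 0] V base by simp
  next
    case 3
    then show ?thesis using one_count V pq by blast
  next
    case 4
    then show ?thesis using one_count V pq base_count_commute[of p 3] by metis
  next
    case 5
    then show ?thesis using adj_count card_common_neighbours V same by simp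
  next
    case 6
    then show ?thesis using base_count_adj_fibre V same by simp
  next
    case 7
    then show ?thesis using base_count_adj_fibre V same' base_count_commute[of 2 1] by simp
  next
    case 8
    then show ?thesis using fibre_count by simp
  qed
qed

lemma distance_regular_rgraph: "distance_regular rgraph"
  unfolding distance_regular_def
proof (intro allI ballI impI)
  fix i j u v u' v'
  assume V: "u \<in> pverts rgraph" "v \<in> pverts rgraph" "u' \<in> pverts rgraph" "v' \<in> pverts rgraph"
    and d: "graph_dist rgraph u v = graph_dist rgraph u' v'"
  have expand: "int (card {w \<in> pverts rgraph. graph_dist rgraph x w = i \<and> graph_dist rgraph y w = j}) =
      (\<Sum>p<4. \<Sum>q<4. rel_coeff i p * rel_coeff j q * base_count p q x y)"
    if "x \<in> pverts rgraph" "y \<in> pverts rgraph" for x y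
  proof -
    have "int (card {w \<in> pverts rgraph. graph_dist rgraph x w = i \<and> graph_dist rgraph y w = j}) =
        (\<Sum>w\<in>pverts rgraph. of_bool (graph_dist rgraph x w = i) * of_bool (graph_dist rgraph y w = j))"
      by (simp only: sum_of_bool_card[symmetric] of_bool_conj)
    also have "\<dots> = (\<Sum>w\<in>pverts rgraph. \<Sum>p<4. \<Sum>q<4.
        rel_coeff i p * rel_coeff j q * (base p x w * base q y w))"
      using that by (intro sum.cong refl) (simp only: dist_indicator sum_product mult_ac)
    also have "\<dots> = (\<Sum>p<4. \<Sum>q<4. rel_coeff i p * rel_coeff j q * base_count p q x y)"
      unfolding base_count_def sum_distrib_left
      by (subst sum.swap, intro sum.cong refl, subst sum.swap) simp
    finally show ?thesis .
  qed
  have "(\<Sum>p<4. \<Sum>q<4. rel_coeff i p * rel_coeff j q * base_count p q u v) =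
      (\<Sum>p<4. \<Sum>q<4. rel_coeff i p * rel_coeff j q * base_count p q u' v')"
    using base_count_eq[OF V d] by (intro sum.cong refl) simp
  then show "card {w \<in> pverts rgraph. graph_dist rgraph u w = i \<and> graph_dist rgraph v w = j} =
      card {w \<in> pverts rgraph. graph_dist rgraph u' w = i \<and> graph_dist rgraph v' w = j}"
    using expand[OF V(1,2)] expand[OF V(3,4)] by simp
qed

lemma drackn_rgraph: "drackn rgraph (roux_fibres \<Gamma> n)"
  unfolding drackn_def
proof (intro conjI ballI impI)
  fix u v assume V: "u \<in> pverts rgraph" "v \<in> pverts rgraph" and "u \<noteq> v"
  then have "graph_dist rgraph u v = graph_diameter rgraph \<longleftrightarrow> fst u = fst v"
    unfolding dist_eq[OF V] diameter_rgraph by (auto simp: one_enat_def numeral_eq_enat)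
  also have "\<dots> \<longleftrightarrow> (\<exists>F\<in>roux_fibres \<Gamma> n. u \<in> F \<and> v \<in> F)"
    using V by (auto simp: roux_fibres_def pverts_rgraph)
  finally show "graph_dist rgraph u v = graph_diameter rgraph \<longleftrightarrow>
      (\<exists>F\<in>roux_fibres \<Gamma> n. u \<in> F \<and> v \<in> F)" .
qed (rule cover_rgraph connected_rgraph distance_regular_rgraph)+

end

section \<open>The group of the cover\<close>

text \<open>\<open>cover_group\<close> describes its generators by their matrices, so the matrices
  must determine the permutations. Both fix everything outside \<open>{1..s}\<close>.\<close>

lemma permutation_mat_eq_iff:
  assumes "\<sigma> permutes {1..s}" "\<tau> permutes {1..s}"
  shows "permutation_mat s \<sigma> = permutation_mat s \<tau> \<longleftrightarrow> \<sigma> = \<tau>"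
proof
  assume eq: "permutation_mat s \<sigma> = permutation_mat s \<tau>"
  show "\<sigma> = \<tau>"
  proof
    fix p
    show "\<sigma> p = \<tau> p"
    proof (cases "p \<in> {1..s}")
      case False
      then show ?thesis using assms by (metis permutes_not_in)
    next
      case True
      then obtain q where q: "p = Suc q" "q < s" by (cases p) auto
      have "\<sigma> p \<in> {1..s}" using True permutes_in_image[OF assms(1)] by blast
      then obtain m where m: "\<sigma> p = Suc m" "m < s" by (cases "\<sigma> p") auto
      have "permutation_mat s \<sigma> $$ (m, q) = 1" using q m by (simp add: permutation_mat_def)
      then have "permutation_mat s \<tau> $$ (m, q) = 1" using eq by simp
      then show ?thesis using q m by (simp add: permutation_mat_def split: if_splits)
    qed
  qed
qed simp

section \<open>The regular representation on positions\<close>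

context roux_drackn
begin

definition position :: "nat \<Rightarrow> 'g" where
  "position = (SOME e. bij_betw e {..<card (carrier \<Gamma>)} (carrier \<Gamma>))"

lemma bij_position: "bij_betw position {..<card (carrier \<Gamma>)} (carrier \<Gamma>)"
proof -
  have "\<exists>e. bij_betw e {..<card (carrier \<Gamma>)} (carrier \<Gamma>)"
    using ex_bij_betw_nat_finite[OF finite_carrier] by (simp add: atLeast0LessThan)
  then show ?thesis unfolding position_def by (rule someI_ex)
qed

abbreviation (input) pos_inv :: "'g \<Rightarrow> nat" where
  "pos_inv \<equiv> inv_into {..<card (carrier \<Gamma>)} position"

lemma position_simps:
  "k < card (carrier \<Gamma>) \<Longrightarrow> position k \<in> carrier \<Gamma>"
  "g \<in> carrier \<Gamma> \<Longrightarrow> position (pos_inv g) = g"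
  "g \<in> carrier \<Gamma> \<Longrightarrow> pos_inv g < card (carrier \<Gamma>)"
  "k < card (carrier \<Gamma>) \<Longrightarrow> pos_inv (position k) = k"
  using bij_betwE[OF bij_position] bij_betw_inv_into_right[OF bij_position]
    bij_betw_inv_into_left[OF bij_position] bij_betwE[OF bij_betw_inv_into[OF bij_position]]
  by auto

text \<open>The regular representation of the group, transported to
  \<open>{1..card (carrier \<Gamma>)}\<close> by an arbitrary enumeration; hence the shifts by one.
  Fixing all other numbers makes it an element of \<open>sym_group\<close>.\<close>

definition translation :: "'g \<Rightarrow> nat \<Rightarrow> nat" where
  "translation g k =
    (if k \<in> {1..card (carrier \<Gamma>)} then Suc (pos_inv (g \<otimes> position (k - 1))) else k)"

lemma translation_Suc:
  "k < card (carrier \<Gamma>) \<Longrightarrow> translation g (Suc k) = Suc (pos_inv (g \<otimes> position k))"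
  by (simp add: translation_def)

lemma translation_mult:
  assumes "g \<in> carrier \<Gamma>" "h \<in> carrier \<Gamma>"
  shows "translation (g \<otimes> h) = translation g \<circ> translation h"
proof
  fix k
  show "translation (g \<otimes> h) k = (translation g \<circ> translation h) k"
  proof (cases "k \<in> {1..card (carrier \<Gamma>)}")
    case True
    then obtain m where m: "k = Suc m" "m < card (carrier \<Gamma>)" by (cases k) auto
    then show ?thesis using assms by (simp add: translation_Suc position_simps m_assoc)
  next
    case False
    then show ?thesis unfolding translation_def by auto
  qed
qed

lemma translation_one: "translation \<one> = id"
proof
  fix k
  show "translation \<one> k = id k"
  proof (cases "k \<in> {1..card (carrier \<Gamma>)}")
    case True
    then obtain m where "k = Suc m" "m < card (carrier \<Gamma>)" by (cases k) auto
    then show ?thesis by (simp add: translation_Suc position_simps)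
  qed (auto simp: translation_def)
qed

lemma translation_permutes:
  assumes g: "g \<in> carrier \<Gamma>"
  shows "translation g permutes {1..card (carrier \<Gamma>)}"
proof (rule bij_imp_permutes)
  have into: "translation h k \<in> {1..card (carrier \<Gamma>)}"
    if h: "h \<in> carrier \<Gamma>" and k: "k \<in> {1..card (carrier \<Gamma>)}" for h k
  proof -
    obtain m where m: "k = Suc m" "m < card (carrier \<Gamma>)" using k by (cases k) auto
    have "pos_inv (h \<otimes> position m) < card (carrier \<Gamma>)" using h m by (simp add: position_simps)
    then show ?thesis using m by (simp add: translation_Suc)
  qed
  have "translation (inv g) (translation g k) = k" "translation g (translation (inv g) k) = k" for k
    using translation_mult[of "inv g" g] translation_mult[of g "inv g"] g translation_one
    by (simp_all add: fun_eq_iff)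
  then show "bij_betw (translation g) {1..card (carrier \<Gamma>)} {1..card (carrier \<Gamma>)}"
    using into g by (intro bij_betwI[where g = "translation (inv g)"]) auto
qed (auto simp: translation_def)

lemma translation_hom: "translation \<in> hom \<Gamma> (sym_group (card (carrier \<Gamma>)))"
  unfolding hom_def sym_group_def using translation_permutes by (auto simp: translation_mult)

lemma translation_group_hom: "group_hom \<Gamma> (sym_group (card (carrier \<Gamma>))) translation"
  using translation_hom sym_group_is_group group_axioms
  by (simp add: group_hom_def group_hom_axioms_def)

abbreviation lab :: "nat \<times> nat \<Rightarrow> nat \<times> 'g" where
  "lab \<equiv> map_prod id position"

lemma cover_labelling_lab:
  "cover_labelling rgraph (roux_fibres \<Gamma> n) n (card (carrier \<Gamma>)) lab"
proof -
  have "bij_betw lab ({..<n} \<times> {..<card (carrier \<Gamma>)}) ({..<n} \<times> carrier \<Gamma>)"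
    by (rule bij_betw_map_prod[OF bij_betw_id bij_position])
  moreover have "lab ` ({i} \<times> {..<card (carrier \<Gamma>)}) = {i} \<times> carrier \<Gamma>" for i
  proof -
    have "lab ` ({i} \<times> A) = {i} \<times> position ` A" for A by force
    then show ?thesis by (simp only: bij_betw_imp_surj_on[OF bij_position])
  qed
  ultimately show ?thesis
    unfolding cover_labelling_def pverts_rgraph roux_fibres_def by simp
qed

lemma cover_block_eq:
  assumes "i < n" "j < n" "i \<noteq> j"
  shows "cover_block rgraph (card (carrier \<Gamma>)) lab i j =
    permutation_mat (card (carrier \<Gamma>)) (translation (b i j))"
proof (rule eq_matI)
  fix p q
  assume "p < dim_row (permutation_mat (card (carrier \<Gamma>)) (translation (b i j)))"
    "q < dim_col (permutation_mat (card (carrier \<Gamma>)) (translation (b i j)))"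
  then have pq: "p < card (carrier \<Gamma>)" "q < card (carrier \<Gamma>)" by (auto simp: permutation_mat_def)
  have "b i j \<otimes> position q \<in> carrier \<Gamma>" using assms pq b_closed by (simp add: position_simps)
  then have "position p = b i j \<otimes> position q \<longleftrightarrow> p = pos_inv (b i j \<otimes> position q)"
    using pq by (metis position_simps(2,4))
  then show "cover_block rgraph (card (carrier \<Gamma>)) lab i j $$ (p, q) =
      permutation_mat (card (carrier \<Gamma>)) (translation (b i j)) $$ (p, q)"
    using pq assms
    by (simp add: cover_block_def permutation_mat_def parcs_rgraph position_simps translation_Suc)
qed (auto simp: cover_block_def permutation_mat_def)

text \<open>Since \<open>b 0 j = \<one>\<close>, the blocks used for normalizing are identity
  matrices, and normalization changes nothing.\<close>

lemma normalized_block_eq: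
  assumes "i < n" "j < n" "i \<noteq> j"
  shows "normalized_block rgraph (card (carrier \<Gamma>)) lab i j =
    permutation_mat (card (carrier \<Gamma>)) (translation (b i j))"
proof -
  have one: "normalizing_block rgraph (card (carrier \<Gamma>)) lab k = 1\<^sub>m (card (carrier \<Gamma>))"
    if "k < n" for k
  proof (cases "k = 0")
    case False
    then have "cover_block rgraph (card (carrier \<Gamma>)) lab 0 k = permutation_mat (card (carrier \<Gamma>)) id"
      using that normalized[of k] by (simp add: cover_block_eq translation_one)
    also have "\<dots> = 1\<^sub>m (card (carrier \<Gamma>))"
      by (rule eq_matI) (auto simp: permutation_mat_def)
    finally show ?thesis using False by (simp add: normalizing_block_def)
  qed (simp add: normalizing_block_def)
  have "cover_block rgraph (card (carrier \<Gamma>)) lab i j \<in>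
      carrier_mat (card (carrier \<Gamma>)) (card (carrier \<Gamma>))" by (simp add: cover_block_def)
  then show ?thesis
    unfolding normalized_block_def one[OF assms(1)] one[OF assms(2)] transpose_one
    using cover_block_eq[OF assms] by simp
qed

text \<open>Every \<open>x \<noteq> \<one>\<close> is of the form \<open>b 0 k \<otimes> b k 1\<close> because \<open>c > 0\<close>.\<close>

lemma generate_b: "generate \<Gamma> {b i j | i j. i < n \<and> j < n \<and> i \<noteq> j} = carrier \<Gamma>" (is "generate \<Gamma> ?B = _")
proof
  show "generate \<Gamma> ?B \<subseteq> carrier \<Gamma>" using b_closed by (intro generate_incl) auto
  show "carrier \<Gamma> \<subseteq> generate \<Gamma> ?B"
  proof
    fix x assume x: "x \<in> carrier \<Gamma>"
    show "x \<in> generate \<Gamma> ?B"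
    proof (cases "x = \<one>")
      case False
      then have "card (middle 0 1 x) = c" using counts[of 0 1 x] normalized[of 1] n_ge_2 x by simp
      then obtain k where k: "k \<in> middle 0 1 x" using c_pos by fastforce
      have B: "b i j \<in> ?B" if "i < n" "j < n" "i \<noteq> j" for i j using that by blast
      have "b 0 k \<in> ?B" "b k 1 \<in> ?B"
        using k n_ge_2 by (intro B; simp add: middle_def)+
      then have "b 0 k \<otimes> b k 1 \<in> generate \<Gamma> ?B" by (intro generate.eng generate.incl)
      then show ?thesis using k by (simp add: middle_def)
    qed (simp add: generate.one)
  qed
qed

text \<open>A homomorphism carries generated subgroups to generated subgroups, and the entries
  \<open>b i j\<close> generate the whole group. So the cover group is the full regular
  representation.\<close>

lemma cover_group_eq:
  "cover_group rgraph n (card (carrier \<Gamma>)) lab = translation ` carrier \<Gamma>"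
proof -
  let ?B = "{b i j | i j. i < n \<and> j < n \<and> i \<noteq> j}" and ?s = "card (carrier \<Gamma>)"
  have "{\<sigma> \<in> carrier (sym_group ?s).
      \<exists>i<n. \<exists>j<n. i \<noteq> j \<and> normalized_block rgraph ?s lab i j = permutation_mat ?s \<sigma>} = translation ` ?B"
  proof (intro equalityI subsetI)
    fix \<sigma> assume "\<sigma> \<in> {\<sigma> \<in> carrier (sym_group ?s).
      \<exists>i<n. \<exists>j<n. i \<noteq> j \<and> normalized_block rgraph ?s lab i j = permutation_mat ?s \<sigma>}"
    then obtain i j where ij: "i < n" "j < n" "i \<noteq> j" and "\<sigma> permutes {1..?s}"
      "permutation_mat ?s (translation (b i j)) = permutation_mat ?s \<sigma>"
      by (auto simp: sym_group_carrier normalized_block_eq)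
    then have "translation (b i j) = \<sigma>"
      using permutation_mat_eq_iff[OF translation_permutes] b_closed by blast
    then show "\<sigma> \<in> translation ` ?B" using ij by blast
  next
    fix \<sigma> assume "\<sigma> \<in> translation ` ?B"
    then obtain i j where ij: "i < n" "j < n" "i \<noteq> j" and \<sigma>: "\<sigma> = translation (b i j)" by blast
    show "\<sigma> \<in> {\<sigma> \<in> carrier (sym_group ?s).
      \<exists>i<n. \<exists>j<n. i \<noteq> j \<and> normalized_block rgraph ?s lab i j = permutation_mat ?s \<sigma>}"
      unfolding \<sigma> using ij normalized_block_eq[OF ij] translation_permutes[OF b_closed[OF ij]]
      by (auto simp: sym_group_carrier)
  qed
  then have "cover_group rgraph n ?s lab = generate (sym_group ?s) (translation ` ?B)"
    by (simp add: cover_group_def)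
  also have "\<dots> = translation ` generate \<Gamma> ?B"
    using b_closed by (intro group_hom.generate_img[OF translation_group_hom]) auto
  finally show ?thesis unfolding generate_b .
qed

lemma regular_cover_rgraph: "regular_cover rgraph (roux_fibres \<Gamma> n)"
  unfolding regular_cover_def
proof (intro exI conjI ballI)
  show "cover_labelling rgraph (roux_fibres \<Gamma> n) n (card (carrier \<Gamma>)) lab" by (rule cover_labelling_lab)
  fix p q assume "p \<in> {1..card (carrier \<Gamma>)}" "q \<in> {1..card (carrier \<Gamma>)}"
  then obtain k l where k: "p = Suc k" "k < card (carrier \<Gamma>)" and l: "q = Suc l" "l < card (carrier \<Gamma>)"
    by (cases p; cases q) auto
  note pos = position_simps(1)[OF k(2)] position_simps(1)[OF l(2)]
  \<comment> \<open>Solving g \<otimes> position k = position l for g gives the one translation that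
    moves p to q.\<close>
  have "translation g p = q \<longleftrightarrow> g = position l \<otimes> inv (position k)" if "g \<in> carrier \<Gamma>" for g
  proof -
    have gk: "g \<otimes> position k \<in> carrier \<Gamma>" using that pos by simp
    have "translation g p = q \<longleftrightarrow> pos_inv (g \<otimes> position k) = l"
      using k l by (simp add: translation_Suc)
    also have "\<dots> \<longleftrightarrow> position l = g \<otimes> position k"
      using position_simps(2)[OF gk] position_simps(4)[OF l(2)] by auto
    also have "\<dots> \<longleftrightarrow> g = position l \<otimes> inv (position k)"
      using inv_solve_right[OF that pos(2,1)] by auto
    finally show ?thesis .
  qed
  moreover have "position l \<otimes> inv (position k) \<in> carrier \<Gamma>" using pos by simp
  ultimately show "\<exists>!\<sigma>. \<sigma> \<in> cover_group rgraph n (card (carrier \<Gamma>)) lab \<and> \<sigma> p = q"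
    unfolding cover_group_eq by blast
qed

lemma abelian_cover_rgraph: "abelian_cover rgraph (roux_fibres \<Gamma> n)"
proof -
  let ?H = "sym_group (card (carrier \<Gamma>))\<lparr>carrier := translation ` carrier \<Gamma>\<rparr>"
  have sub: "subgroup (translation ` carrier \<Gamma>) (sym_group (card (carrier \<Gamma>)))"
    by (rule group_hom.img_is_subgroup[OF translation_group_hom])
  have "comm_group ?H"
  proof (rule group.group_comm_groupI)
    show "group ?H" by (rule group.subgroup_imp_group[OF sym_group_is_group sub])
    fix x y assume "x \<in> carrier ?H" "y \<in> carrier ?H"
    then obtain g h where "g \<in> carrier \<Gamma>" "h \<in> carrier \<Gamma>" "x = translation g" "y = translation h"
      by auto
    then show "x \<otimes>\<^bsub>?H\<^esub> y = y \<otimes>\<^bsub>?H\<^esub> x"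
      using translation_mult m_comm by (metis sym_group_mult monoid.surjective monoid.update_convs(1) partial_object.update_convs(1) monoid.simps(1))
  qed
  then show ?thesis
    unfolding abelian_cover_def using cover_labelling_lab cover_group_eq by metis
qed

end

section \<open>Signature matrices and roux\<close>

lemma (in roux_drackn) regular_abelian_drackn_rgraph:
  "regular_abelian_drackn rgraph (roux_fibres \<Gamma> n)"
  unfolding regular_abelian_drackn_def
  using drackn_rgraph regular_cover_rgraph abelian_cover_rgraph by blast

text \<open>The evaluation of the roux is \<open>S\<close> itself, so the representatives of the
  lines that give \<open>S\<close> also serve the roux.\<close>

lemma drackn_linesI:
  fixes \<Gamma> :: "nat monoid"
  assumes "roux_drackn \<Gamma> n b a c" "group_character \<Gamma> \<alpha>"
    and dep: "linearly_dependent_lines d n L" and sig: "lines_have_signature_matrix d n L S"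
    and S: "S \<in> carrier_mat n n" "\<And>i. i < n \<Longrightarrow> S $$ (i, i) = 0"
      "\<And>i j. \<lbrakk>i < n; j < n; i \<noteq> j\<rbrakk> \<Longrightarrow> S $$ (i, j) = \<alpha> (b i j)"
  shows "drackn_lines d n L"
proof -
  interpret roux_drackn \<Gamma> n b a c by fact
  have "eval_at_character \<Gamma> \<alpha> rmat = S"
    using S by (intro eq_matI) (simp_all add: eval_rmat_index, simp_all add: eval_at_character_def rmat_def)
  then show ?thesis
    unfolding drackn_lines_def
    using dep sig roux_rmat assms(2) regular_abelian_drackn_rgraph by blast
qed

lemma signature_matrix_entries:
  assumes "signature_matrix n S"
  shows "S \<in> carrier_mat n n" "i < n \<Longrightarrow> S $$ (i, i) = 0"
    "\<lbrakk>i < n; j < n; i \<noteq> j\<rbrakk> \<Longrightarrow> cmod (S $$ (i, j)) = 1"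
    "\<lbrakk>i < n; j < n\<rbrakk> \<Longrightarrow> S $$ (j, i) = cnj (S $$ (i, j))"
proof -
  show C: "S \<in> carrier_mat n n" and "i < n \<Longrightarrow> S $$ (i, i) = 0"
    "\<lbrakk>i < n; j < n; i \<noteq> j\<rbrakk> \<Longrightarrow> cmod (S $$ (i, j)) = 1"
    using assms by (auto simp: signature_matrix_def)
  show "S $$ (j, i) = cnj (S $$ (i, j))" if ij: "i < n" "j < n"
  proof -
    have "mat_adjoint S $$ (j, i) = cnj (S $$ (i, j))"
      using C ij by (simp add: mat_adjoint_def mat_of_rows_index)
    then show ?thesis using assms by (simp add: signature_matrix_def)
  qed
qed

lemma rouxD:
  assumes "roux \<Gamma> n B"
  shows "comm_group \<Gamma>" "finite (carrier \<Gamma>)" "B \<in> carrier_mat n n"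
    "i < n \<Longrightarrow> B $$ (i, i) = (\<lambda>_. 0)"
    "\<lbrakk>i < n; j < n; i \<noteq> j\<rbrakk> \<Longrightarrow> B $$ (i, j) \<in> gr_of ` carrier \<Gamma>"
    "\<lbrakk>i < n; j < n; i \<noteq> j; g \<in> carrier \<Gamma>; B $$ (i, j) = gr_of g\<rbrakk> \<Longrightarrow>
      B $$ (j, i) = gr_of (inv\<^bsub>\<Gamma>\<^esub> g)"
  using assms unfolding roux_def by (elim conjE, blast)+

lemma drackn_lines_imp_spectra:
  assumes n: "n \<ge> 2" and lines: "drackn_lines d n L"
    and S: "normalized_signature_matrix d n L S"
  shows "\<exists>r::nat.
       (r > 0 \<and> (\<forall>i<n. \<forall>j<n. i \<noteq> j \<longrightarrow> (S $$ (i, j)) ^ r = 1) \<and>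
        (\<forall>m. 0 < m \<and> m < r \<longrightarrow> \<not> (\<forall>i<n. \<forall>j<n. i \<noteq> j \<longrightarrow> (S $$ (i, j)) ^ m = 1))) \<and>
       (\<exists>\<theta> \<tau> :: complex. \<forall>k \<in> {1..r - 1}. spectrum (hadamard_power S k) = {\<theta>, \<tau>})"
proof -
  obtain \<Gamma> :: "nat monoid" and B \<alpha> where \<Gamma>: "roux \<Gamma> n B" "group_character \<Gamma> \<alpha>"
    "regular_abelian_drackn (roux_graph \<Gamma> n B) (roux_fibres \<Gamma> n)"
    "lines_have_signature_matrix d n L (eval_at_character \<Gamma> \<alpha> B)"
    using lines unfolding drackn_lines_def by blast
  have sS: "lines_have_signature_matrix d n L S" and normal: "\<And>i. \<lbrakk>i < n; i \<noteq> 0\<rbrakk> \<Longrightarrow> S $$ (0, i) = 1"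
    using S unfolding normalized_signature_matrix_def by auto
  note R = rouxD[OF \<Gamma>(1)]
  \<comment> \<open>The group elements behind the off-diagonal entries; injectivity of
    \<open>gr_of\<close> carries (R3) over to them.\<close>
  define b where "b i j = (SOME g. g \<in> carrier \<Gamma> \<and> B $$ (i, j) = gr_of g)" for i j
  have b: "b i j \<in> carrier \<Gamma> \<and> B $$ (i, j) = gr_of (b i j)" if "i < n" "j < n" "i \<noteq> j" for i j
  proof -
    have "\<exists>g. g \<in> carrier \<Gamma> \<and> B $$ (i, j) = gr_of g" using R(5)[OF that] by blast
    then show ?thesis unfolding b_def by (rule someI_ex)
  qed
  have inv: "B $$ (j, i) = gr_of (inv\<^bsub>\<Gamma>\<^esub> (b i j))" if "i < n" "j < n" "i \<noteq> j" for i j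
    using R(6)[OF that] b[OF that] by blast
  have "roux_array \<Gamma> n b"
  proof (intro roux_array.intro roux_array_axioms.intro)
    show "comm_group \<Gamma>" "finite (carrier \<Gamma>)" by (rule R)+
    show "b j i = inv\<^bsub>\<Gamma>\<^esub> b i j" if "i < n" "j < n" "i \<noteq> j" for i j
      using inv[OF that] b[OF that(2,1)] that(3) by (simp add: gr_of_eq_iff)
  qed (use b in blast)
  then interpret roux_array \<Gamma> n b .
  have B: "B = rmat"
  proof (rule eq_matI)
    fix i j assume "i < dim_row rmat" "j < dim_col rmat"
    then have ij: "i < n" "j < n" by (auto simp: rmat_def)
    show "B $$ (i, j) = rmat $$ (i, j)" using b[OF ij] R(4)[OF ij(2)] by (simp add: rmat_index[OF ij])
  qed (use R(3) in \<open>auto simp: rmat_def\<close>)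
  have SC: "S \<in> carrier_mat n n"
    using sS signature_matrix_entries(1)
    unfolding lines_have_signature_matrix_def vectors_have_signature_matrix_def by blast
  obtain e where e: "\<And>i. i < n \<Longrightarrow> cmod (e i) = 1"
    "\<And>i j. \<lbrakk>i < n; j < n\<rbrakk> \<Longrightarrow> S $$ (i, j) = e j * cnj (e i) * eval_at_character \<Gamma> \<alpha> rmat $$ (i, j)"
    using signature_matrix_switching[OF n sS \<Gamma>(4)[unfolded B]] by blast
  have "drackn rgraph (roux_fibres \<Gamma> n)"
    using \<Gamma>(3) unfolding B regular_abelian_drackn_def by blast
  then show ?thesis using drackn_imp_spectra[OF n _ \<Gamma>(2) SC e normal] by blast
qed

section \<open>Cyclic groups and roots of unity\<close>

definition cyclic_monoid :: "nat \<Rightarrow> nat monoid" where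
  "cyclic_monoid r = \<lparr>carrier = {..<r}, monoid.mult = (\<lambda>x y. (x + y) mod r), one = 0\<rparr>"

lemma cyclic_monoid_simps:
  "carrier (cyclic_monoid r) = {..<r}" "x \<otimes>\<^bsub>cyclic_monoid r\<^esub> y = (x + y) mod r"
  "\<one>\<^bsub>cyclic_monoid r\<^esub> = 0"
  by (simp_all add: cyclic_monoid_def)

lemma cyclic_comm_group:
  assumes "r > 0"
  shows "comm_group (cyclic_monoid r)"
proof (rule comm_groupI, unfold cyclic_monoid_simps)
  fix x assume "x \<in> {..<r}"
  then have "((r - x) mod r + x) mod r = 0" by (simp add: mod_simps)
  then show "\<exists>y\<in>{..<r}. (y + x) mod r = 0" using assms by (intro bexI[of _ "(r - x) mod r"]) auto
qed (use assms in \<open>auto simp: mod_simps add_ac\<close>)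

lemma cyclic_inv_eq:
  assumes "r > 0" "x < r" "y < r" "(x + y) mod r = 0"
  shows "inv\<^bsub>cyclic_monoid r\<^esub> x = y"
proof -
  interpret comm_group "cyclic_monoid r" by (rule cyclic_comm_group[OF assms(1)])
  show ?thesis using assms by (intro inv_equality) (auto simp: cyclic_monoid_simps add.commute)
qed

text \<open>The cover behind the case \<open>r = 1\<close> is the complete bipartite graph minus a perfect matching.\<close>

lemma crown_roux_drackn:
  assumes n: "n > 2"
  shows "roux_drackn (cyclic_monoid 2) n (\<lambda>i j. if i = 0 \<or> j = 0 then 0 else 1) 0 (n - 2)"
proof -
  \<comment> \<open>The value 1 at all off-diagonal positions would give the same cover; exchanging
    the two vertices of fibre 0 turns the first row into identities.\<close>
  define b :: "nat \<Rightarrow> nat \<Rightarrow> nat" where "b i j = (if i = 0 \<or> j = 0 then 0 else 1)" for i j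
  have inv: "inv\<^bsub>cyclic_monoid 2\<^esub> x = x" if "x < 2" for x
    using that by (intro cyclic_inv_eq) auto
  have arr: "roux_array (cyclic_monoid 2) n b"
    using cyclic_comm_group[of 2]
    by (intro roux_array.intro roux_array_axioms.intro) (auto simp: cyclic_monoid_simps b_def inv)
  interpret roux_array "cyclic_monoid 2" n b by (rule arr)
  have "card (middle i j x) = (if x = b i j then 0 else n - 2)"
    if ij: "i < n" "j < n" "i \<noteq> j" and x: "x \<in> carrier (cyclic_monoid 2)" for i j x
  proof -
    \<comment> \<open>The three values along any triangle have an odd sum. So no k yields
      \<open>b i j\<close> and all n - 2 of them yield the other element: a = 0 and c = n -
      2.\<close>
    have sum: "(b i k + b k j) mod 2 = 1 - b i j" if "k \<noteq> i" "k \<noteq> j" for k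
      using that ij by (auto simp: b_def)
    have x2: "x = 1 - b i j \<longleftrightarrow> x \<noteq> b i j"
      using x by (auto simp: cyclic_monoid_simps b_def less_2_cases_iff)
    have "middle i j x = (if x = b i j then {} else {..<n} - {i, j})"
      unfolding middle_def cyclic_monoid_simps using sum x2 by auto
    then show ?thesis using ij by (simp add: card_Diff_subset numeral_2_eq_2)
  qed
  then have "roux_drackn (cyclic_monoid 2) n b 0 (n - 2)"
    using arr n by (intro roux_drackn.intro roux_drackn_axioms.intro)
      (auto simp: cyclic_monoid_simps b_def)
  then show ?thesis by (simp add: b_def[abs_def])
qed

lemma roots_of_unity_cis:
  assumes "r > 0"
  defines "\<omega> \<equiv> cis (2 * pi / real r)"
  shows "\<omega> ^ r = 1" "cmod \<omega> = 1" "z ^ r = 1 \<Longrightarrow> \<exists>k<r. z = \<omega> ^ k"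
    "\<lbrakk>k < r; l < r\<rbrakk> \<Longrightarrow> \<omega> ^ k = \<omega> ^ l \<longleftrightarrow> k = l"
proof -
  have pow: "\<omega> ^ k = cis (2 * pi * real k / real r)" for k
    unfolding \<omega>_def DeMoivre by (simp add: mult_ac)
  note bij = bij_betw_roots_unity[OF assms(1), folded pow]
  show "\<omega> ^ r = 1" using assms(1) by (simp add: pow)
  show "cmod \<omega> = 1" by (simp add: \<omega>_def)
  show "\<exists>k<r. z = \<omega> ^ k" if "z ^ r = 1"
    using that bij_betw_imp_surj_on[OF bij] by (metis (mono_tags, lifting) imageE lessThan_iff mem_Collect_eq)
  show "\<omega> ^ k = \<omega> ^ l \<longleftrightarrow> k = l" if "k < r" "l < r"
    using that bij_betw_imp_inj_on[OF bij] by (auto simp: inj_on_def)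
qed

text \<open>The orthogonality relation behind Fourier inversion on Z/r.\<close>

lemma sum_powers_root_of_unity:
  fixes z :: complex
  assumes "z ^ r = 1"
  shows "(\<Sum>k<r. z ^ k) = (if z = 1 then of_nat r else 0)"
  using assms by (simp add: geometric_sum)

lemma hermitian_hadamard_power:
  assumes "signature_matrix n S"
  shows "hermitian_mat n (hadamard_power S k)"
  unfolding hermitian_mat_def
proof (intro conjI allI impI)
  note C = signature_matrix_entries[OF assms]
  show "hadamard_power S k \<in> carrier_mat n n" using C(1) by (simp add: hadamard_power_def)
  fix i j assume "i < n" "j < n"
  then show "hadamard_power S k $$ (j, i) = cnj (hadamard_power S k $$ (i, j))"
    using C(1) C(4)[of i j] by (simp add: hadamard_power_def)
qed

text \<open>Each Hadamard power of \<open>S\<close> is the evaluation of the roux at a character of \<open>\<int>/r\<close>, so the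
  numbers of middle vertices are recovered from the spectra by Fourier inversion.\<close>

lemma spectra_imp_roux_drackn:
  assumes n: "n > 2" and sS: "signature_matrix n S" and r: "r > 1"
    and normal: "\<And>i. \<lbrakk>i < n; i \<noteq> 0\<rbrakk> \<Longrightarrow> S $$ (0, i) = 1"
    and root: "\<And>i j. \<lbrakk>i < n; j < n; i \<noteq> j\<rbrakk> \<Longrightarrow> (S $$ (i, j)) ^ r = 1"
    and nontriv: "\<not> (\<forall>i<n. \<forall>j<n. i \<noteq> j \<longrightarrow> S $$ (i, j) = 1)"
    and spec: "\<And>k. k \<in> {1..r - 1} \<Longrightarrow> spectrum (hadamard_power S k) = {\<theta>, \<tau>}"
  obtains b a c \<alpha> where "roux_drackn (cyclic_monoid r) n b a c" "group_character (cyclic_monoid r) \<alpha>"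
    "\<And>i j. \<lbrakk>i < n; j < n; i \<noteq> j\<rbrakk> \<Longrightarrow> S $$ (i, j) = \<alpha> (b i j)"
proof -
  define \<omega> where "\<omega> = cis (2 * pi / real r)"
  have r0: "r > 0" using r by simp
  note \<omega> = roots_of_unity_cis[OF r0, folded \<omega>_def]
  note C = signature_matrix_entries[OF sS]
  have \<omega>_mod: "\<omega> ^ (x mod r) = \<omega> ^ x" for x
  proof -
    have "\<omega> ^ x = \<omega> ^ (r * (x div r) + x mod r)" by simp
    then show ?thesis by (simp only: power_add power_mult \<omega>(1) power_one mult_1_left)
  qed
  define \<alpha> where "\<alpha> x = \<omega> ^ x" for x
  have \<alpha>: "group_character (cyclic_monoid r) \<alpha>"
    unfolding group_character_def cyclic_monoid_simps \<alpha>_def \<omega>_mod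
    by (simp add: norm_power \<omega>(2) power_add)
  have "\<forall>i j. \<exists>k. i < n \<and> j < n \<and> i \<noteq> j \<longrightarrow> k < r \<and> S $$ (i, j) = \<omega> ^ k"
    using root \<omega>(3) by blast
  \<comment> \<open>Discrete logarithms of the entries to the base \<omega>, taken as elements of
    Z/r.\<close>
  then obtain b where b: "\<And>i j. \<lbrakk>i < n; j < n; i \<noteq> j\<rbrakk> \<Longrightarrow> b i j < r \<and> S $$ (i, j) = \<omega> ^ b i j"
    by metis
  have arr: "roux_array (cyclic_monoid r) n b"
  proof (intro roux_array.intro roux_array_axioms.intro)
    show "comm_group (cyclic_monoid r)" by (rule cyclic_comm_group[OF r0])
    fix i j assume ij: "i < n" "j < n" "i \<noteq> j"
    have "\<omega> ^ b i j * \<omega> ^ b j i = S $$ (i, j) * cnj (S $$ (i, j))"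
      using b[OF ij] b[OF ij(2,1)] ij(3) C(4)[OF ij(1,2)] by simp
    also have "\<dots> = 1"
      using C(3)[OF ij] by (metis complex_norm_square of_real_1 one_power2)
    finally have "\<omega> ^ ((b i j + b j i) mod r) = \<omega> ^ 0" by (simp add: \<omega>_mod power_add)
    then have "(b i j + b j i) mod r = 0" using \<omega>(4)[of "(b i j + b j i) mod r" 0] r0 by simp
    then show "b j i = inv\<^bsub>cyclic_monoid r\<^esub> b i j"
      using b[OF ij] b[OF ij(2,1)] ij(3) by (intro cyclic_inv_eq[OF r0, symmetric]) auto
  qed (use b in \<open>auto simp: cyclic_monoid_simps\<close>)
  interpret roux_array "cyclic_monoid r" n b by (rule arr)
  let ?\<sigma> = "\<theta> + \<tau>"
  \<comment> \<open>The Fourier coefficients of the counts. At k = 0 all n - 2 middle indices are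
    counted; for k > 0 the quadratic applies, and off the diagonal only the sum of its roots is
    visible.\<close>
  have fourier: "(\<Sum>y<r. of_nat (card (middle i j y)) * (\<omega> ^ y) ^ k) =
      (if k = 0 then of_nat (n - 2) else ?\<sigma> * (\<omega> ^ b i j) ^ k)"
    if ij: "i < n" "j < n" "i \<noteq> j" and k: "k < r" for i j k
  proof -
    let ?T = "eval_at_character (cyclic_monoid r) (\<lambda>x. \<alpha> x ^ k) rmat"
    have "(\<Sum>y<r. of_nat (card (middle i j y)) * (\<omega> ^ y) ^ k) = (\<Sum>l<n. ?T $$ (i, l) * ?T $$ (l, j))"
      using sum_middle[OF group_character_power[OF \<alpha>, of k] ij(1,2)]
      by (simp add: \<alpha>_def cyclic_monoid_simps)
    also have "\<dots> = (if k = 0 then of_nat (n - 2) else ?\<sigma> * (\<omega> ^ b i j) ^ k)"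
    proof (cases "k = 0")
      case True
      have "(\<Sum>l<n. ?T $$ (i, l) * ?T $$ (l, j)) = (\<Sum>l\<in>{..<n} - {i, j}. 1)"
        using True ij by (intro sum.mono_neutral_cong_right) (auto simp: eval_rmat_index)
      also have "\<dots> = of_nat (n - 2)" using ij by (simp add: card_Diff_subset numeral_2_eq_2)
      finally show ?thesis using True by simp
    next
      case False
      let ?H = "hadamard_power S k"
      have H: "?T $$ (i, j) = ?H $$ (i, j)" if "i < n" "j < n" for i j
        using that False b[OF that] C(1) C(2)
        by (auto simp: eval_rmat_index hadamard_power_def \<alpha>_def)
      have "(\<Sum>l<n. ?T $$ (i, l) * ?T $$ (l, j)) = (\<Sum>l<n. ?H $$ (i, l) * ?H $$ (l, j))"
        using ij by (intro sum.cong) (auto simp: H)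
      also have "\<dots> = ?\<sigma> * ?H $$ (i, j)"
        using hermitian_mat_two_eigenvalues[OF hermitian_hadamard_power[OF sS] spec ij(1,2), of k]
          False k ij(3) by simp
      also have "?H $$ (i, j) = (\<omega> ^ b i j) ^ k"
        using ij b[OF ij] C(1) by (simp add: hadamard_power_def)
      finally show ?thesis using False by simp
    qed
    finally show ?thesis .
  qed
  have cnj1: "cnj (\<omega> ^ x) * \<omega> ^ x = 1" for x
    using \<omega>(2) by (metis complex_norm_square mult.commute norm_power of_real_1 one_power2 power_one)
  have quot: "(\<Sum>k<r. (cnj (\<omega> ^ x) * \<omega> ^ y) ^ k) = (if y = x then of_nat r else 0)"
    if "x < r" "y < r" for x y
  proof -
    have "(cnj (\<omega> ^ x) * \<omega> ^ y) ^ r = 1"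
    proof -
      have "(\<omega> ^ z) ^ r = 1" for z by (metis \<omega>(1) mult.commute power_mult power_one)
      then show ?thesis by (simp only: power_mult_distrib complex_cnj_power[symmetric] complex_cnj_one mult_1_left)
    qed
    moreover have "cnj (\<omega> ^ x) * \<omega> ^ y = 1 \<longleftrightarrow> y = x"
    proof -
      have "cnj (\<omega> ^ x) * \<omega> ^ y = 1 \<longleftrightarrow> \<omega> ^ y = \<omega> ^ x"
        using cnj1[of x] by (metis mult.assoc mult.commute mult_1_left)
      then show ?thesis using \<omega>(4) that by simp
    qed
    ultimately show ?thesis by (simp add: sum_powers_root_of_unity)
  qed
  \<comment> \<open>Fourier inversion. The right-hand side depends on i, j and x only through the
    truth of x = b i j, which is exactly what two constants a and c require.\<close>
  have count: "of_nat r * of_nat (card (middle i j x)) =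
      of_nat (n - 2) + ?\<sigma> * ((if x = b i j then of_nat r else 0) - 1)"
    if ij: "i < n" "j < n" "i \<noteq> j" and x: "x < r" for i j x
  proof -
    have bij: "b i j < r" using b[OF ij] by blast
    have "(\<Sum>k<r. cnj (\<omega> ^ x) ^ k * (\<Sum>y<r. of_nat (card (middle i j y)) * (\<omega> ^ y) ^ k)) =
        (\<Sum>y<r. of_nat (card (middle i j y)) * (\<Sum>k<r. (cnj (\<omega> ^ x) * \<omega> ^ y) ^ k))"
      unfolding sum_distrib_left power_mult_distrib by (subst sum.swap) (simp only: mult_ac)
    also have "\<dots> = (\<Sum>y<r. if y = x then of_nat r * of_nat (card (middle i j x)) else 0)"
      using x by (intro sum.cong) (auto simp: quot simp del: complex_cnj_power)
    also have "\<dots> = of_nat r * of_nat (card (middle i j x))" using x by simp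
    finally have "of_nat r * of_nat (card (middle i j x)) =
        (\<Sum>k<r. cnj (\<omega> ^ x) ^ k * (if k = 0 then of_nat (n - 2) else ?\<sigma> * (\<omega> ^ b i j) ^ k))"
      using fourier[OF ij] by simp
    also have "\<dots> = (\<Sum>k<r. ?\<sigma> * (cnj (\<omega> ^ x) * \<omega> ^ b i j) ^ k +
        (if k = 0 then of_nat (n - 2) - ?\<sigma> else 0))"
      unfolding power_mult_distrib by (intro sum.cong) auto
    also have "\<dots> = ?\<sigma> * (\<Sum>k<r. (cnj (\<omega> ^ x) * \<omega> ^ b i j) ^ k) + (of_nat (n - 2) - ?\<sigma>)"
      unfolding sum.distrib sum_distrib_left using r0 by simp
    finally show ?thesis using quot[OF x bij] by (auto simp: algebra_simps)
  qed
  have b0: "b 0 j = 0" if "0 < j" "j < n" for j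
  proof -
    have "\<omega> ^ b 0 j = \<omega> ^ 0" using b[of 0 j] normal[of j] that by simp
    then show ?thesis using \<omega>(4)[of "b 0 j" 0] b[of 0 j] that r0 by simp
  qed
  \<comment> \<open>Read off at the pair (0, 1), where \<open>b 0 1 = 0\<close>: the element 0 is
    the entry itself, and 1 differs from it because r > 1.\<close>
  define a where "a = card (middle 0 1 0)"
  define c where "c = card (middle 0 1 1)"
  have eq: "card (middle i j x) = card (middle 0 1 y)"
    if ij: "i < n" "j < n" "i \<noteq> j" and x: "x < r" and y: "y < r" and xy: "x = b i j \<longleftrightarrow> y = 0" for i j x y
  proof -
    have "complex_of_nat r * of_nat (card (middle i j x)) = of_nat r * of_nat (card (middle 0 1 y))"
      using count[OF ij x] count[of 0 1 y] n y xy b0[of 1] by simp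
    then show ?thesis using r0 by simp
  qed
  have counts: "card (middle i j x) = (if x = b i j then a else c)"
    if ij: "i < n" "j < n" "i \<noteq> j" and x: "x \<in> carrier (cyclic_monoid r)" for i j x
    using eq[OF ij, of x 0] eq[OF ij, of x 1] x r by (auto simp: a_def c_def cyclic_monoid_simps)
  \<comment> \<open>The index 0 lies between any i, j > 0 and yields b i 0 + b 0 j = 0. If c were 0,
    this would force \<open>b i j = 0\<close> throughout, so that \<open>S\<close> would have only
    ones off the diagonal.\<close>
  have "c > 0"
  proof (rule ccontr)
    assume "\<not> c > 0"
    then have c0: "c = 0" by simp
    have "S $$ (i, j) = 1" if ij: "i < n" "j < n" "i \<noteq> j" for i j
    proof (cases "i = 0 \<or> j = 0")
      case True
      then show ?thesis using normal[of j] normal[of i] C(4)[of 0 i] ij by auto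
    next
      case False
      have "b i 0 = 0"
      proof -
        have "\<omega> ^ b i 0 = \<omega> ^ 0" using b[of i 0] normal[of i] C(4)[of 0 i] ij False by simp
        then show ?thesis using \<omega>(4)[of "b i 0" 0] b[of i 0] ij False r0 by simp
      qed
      then have "0 \<in> middle i j 0"
        using ij False b0[of j] by (simp add: middle_def cyclic_monoid_simps)
      moreover have "finite (middle i j 0)" by (simp add: middle_def)
      ultimately have "card (middle i j 0) \<noteq> 0" by auto
      then have "b i j = 0" using counts[OF ij, of 0] r0 c0 by (auto simp: cyclic_monoid_simps split: if_splits)
      then show ?thesis using b[OF ij] by simp
    qed
    then show False using nontriv by blast
  qed
  then have "roux_drackn (cyclic_monoid r) n b a c"
    using arr counts n b0 r
    by (intro roux_drackn.intro roux_drackn_axioms.intro)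
      (auto simp: cyclic_monoid_simps intro!: bexI[of _ 1])
  moreover have "S $$ (i, j) = \<alpha> (b i j)" if "i < n" "j < n" "i \<noteq> j" for i j
    using b[OF that] by (simp add: \<alpha>_def)
  ultimately show thesis using that \<alpha> by blast
qed

theorem corollary5p2:
  fixes n d :: nat and L :: "nat \<Rightarrow> complex vec set" and S :: "complex mat"
  assumes "n > 2"
    and "\<forall>i<n. is_line d (L i)"
    and "linearly_dependent_lines d n L"
    and "equiangular_lines d n L"
    and "normalized_signature_matrix d n L S"
  shows "drackn_lines d n L \<longleftrightarrow>
    (\<exists>r::nat.
       (r > 0 \<and> (\<forall>i<n. \<forall>j<n. i \<noteq> j \<longrightarrow> (S $$ (i, j)) ^ r = 1) \<and>
        (\<forall>m. 0 < m \<and> m < r \<longrightarrow> \<not> (\<forall>i<n. \<forall>j<n. i \<noteq> j \<longrightarrow> (S $$ (i, j)) ^ m = 1))) \<and>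
       (\<exists>\<theta> \<tau> :: complex. \<forall>k \<in> {1..r - 1}. spectrum (hadamard_power S k) = {\<theta>, \<tau>}))"
proof
  assume "drackn_lines d n L"
  from drackn_lines_imp_spectra[OF less_imp_le[OF assms(1)] this assms(5)]
  show "\<exists>r::nat.
       (r > 0 \<and> (\<forall>i<n. \<forall>j<n. i \<noteq> j \<longrightarrow> (S $$ (i, j)) ^ r = 1) \<and>
        (\<forall>m. 0 < m \<and> m < r \<longrightarrow> \<not> (\<forall>i<n. \<forall>j<n. i \<noteq> j \<longrightarrow> (S $$ (i, j)) ^ m = 1))) \<and>
       (\<exists>\<theta> \<tau> :: complex. \<forall>k \<in> {1..r - 1}. spectrum (hadamard_power S k) = {\<theta>, \<tau>})" .
next
  assume "\<exists>r::nat.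
       (r > 0 \<and> (\<forall>i<n. \<forall>j<n. i \<noteq> j \<longrightarrow> (S $$ (i, j)) ^ r = 1) \<and>
        (\<forall>m. 0 < m \<and> m < r \<longrightarrow> \<not> (\<forall>i<n. \<forall>j<n. i \<noteq> j \<longrightarrow> (S $$ (i, j)) ^ m = 1))) \<and>
       (\<exists>\<theta> \<tau> :: complex. \<forall>k \<in> {1..r - 1}. spectrum (hadamard_power S k) = {\<theta>, \<tau>})"
  then obtain r \<theta> \<tau> where r: "r > 0"
    and root_all: "\<forall>i<n. \<forall>j<n. i \<noteq> j \<longrightarrow> (S $$ (i, j)) ^ r = 1"
    and min: "\<forall>m. 0 < m \<and> m < r \<longrightarrow> \<not> (\<forall>i<n. \<forall>j<n. i \<noteq> j \<longrightarrow> (S $$ (i, j)) ^ m = 1)"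
    and spec_all: "\<forall>k\<in>{1..r - 1}. spectrum (hadamard_power S k) = {\<theta>, \<tau>}"
    by (elim exE conjE)
  from spec_all have spec: "\<And>k. k \<in> {1..r - 1} \<Longrightarrow> spectrum (hadamard_power S k) = {\<theta>, \<tau>}" by (rule bspec)
  have root: "\<And>i j. \<lbrakk>i < n; j < n; i \<noteq> j\<rbrakk> \<Longrightarrow> (S $$ (i, j)) ^ r = 1" using root_all by simp
  have sig: "lines_have_signature_matrix d n L S"
    and normal: "\<And>i. \<lbrakk>i < n; i \<noteq> 0\<rbrakk> \<Longrightarrow> S $$ (0, i) = 1"
    using assms(5) unfolding normalized_signature_matrix_def by auto
  then have sS: "signature_matrix n S"
    unfolding lines_have_signature_matrix_def vectors_have_signature_matrix_def by blast
  note C = signature_matrix_entries[OF sS]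
  show "drackn_lines d n L"
  \<comment> \<open>For r = 1 the range of k in (b) is empty and no spectrum is given, but
    \<open>S\<close> has only ones off the diagonal. Any DRACKN roux on n fibres becomes
    \<open>S\<close> at the trivial character, so the group need not have order r.\<close>
  proof (cases "r = 1")
    case True
    have "group_character (cyclic_monoid 2) (\<lambda>_. 1)" by (simp add: group_character_def)
    then show ?thesis
      using root True by (intro drackn_linesI[OF crown_roux_drackn[OF assms(1)] _ assms(3) sig C(1,2)]) auto
  next
    case False
    then have r1: "r > 1" using r by simp
    \<comment> \<open>Minimality of r, applied to the exponent 1.\<close>
    have nt: "\<not> (\<forall>i<n. \<forall>j<n. i \<noteq> j \<longrightarrow> S $$ (i, j) = 1)"
      using min[rule_format, of 1] r1 by simp
    show ?thesis
    proof (rule spectra_imp_roux_drackn[OF assms(1) sS r1 normal root nt spec])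
      fix b a c \<alpha>
      assume rd: "roux_drackn (cyclic_monoid r) n b a c" "group_character (cyclic_monoid r) \<alpha>"
        "\<And>i j. \<lbrakk>i < n; j < n; i \<noteq> j\<rbrakk> \<Longrightarrow> S $$ (i, j) = \<alpha> (b i j)"
      show "drackn_lines d n L" by (rule drackn_linesI[OF rd(1,2) assms(3) sig C(1,2) rd(3)])
    qed
  qed
qed

end
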